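(* Consider the original problem (S) and the relaxed problem (R) defined in the context. An optimal solution of the relaxed problem (R) is also an optimal solution of the original problem (S), and vice versa.
   Context: Data: integers $n,N,T\ge 1$ and $m_1,\dots,m_N\ge 1$; real matrices $A_t\in\mathbb{R}^{n\times n}$, $B_t(j)\in\mathbb{R}^{n\times m_j}$ and symmetric positive definite $R_t(j)\in\mathbb{R}^{m_j\times m_j}$ for $t=0,\dots,T-1$, $j=1,\dots,N$; symmetric positive definite $Q_t\in\mathbb{R}^{n\times n}$ for $t=0,\dots,T$; covariance matrices $W_t\in\mathbb{R}^{n\times n}$ for $t=-1,\dots,T-1$. Put $\bar W_{t-1}=A_tW_{t-1}A_t^\top$ for $t=0,\dots,T-1$, $h_t(M)=A_t^\top M A_t+Q_t$, and $\mathsf{V}_t=\{B_t(j)R_t(j)^{-1}B_t(j)^\top : j=1,\dots,N\}$. All matrix variables below are real symmetric $n\times n$; $\succeq$ denotes the positive semidefinite order. Problem (S): minimize $\sum_{t=0}^{T-1}\mathrm{tr}(K_{t|t+1}\bar W_{t-1})$ over schedules $\sigma:\{0,\dots,T-1\}\to\{1,\dots,N\}$ and matrices $K_t,K_{t|t+1},P_t,P_{t|t+1}$ (where $K_t=P_t^{-1}$) subject to $P_T=Q_T^{-1}$ and, for all $t=0,\dots,T-1$: $K_{t|t+1}=P_{t|t+1}^{-1}$, $P_{t|t+1}=P_{t+1}+B_t(\sigma(t))R_t(\sigma(t))^{-1}B_t(\sigma(t))^\top$, and $P_t^{-1}=h_t(K_{t|t+1})$. Problem (R): minimize $\sum_{t=0}^{T-1}\mathrm{tr}(K_{t|t+1}\bar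 W_{t-1})$ over matrices $K_{t|t+1},P_{t|t+1},P_t,V_t$ subject to $P_T=Q_T^{-1}$ and, for all $t=0,\dots,T-1$: $P_{t|t+1}=P_{t+1}+V_t$, $V_t\in\mathsf{V}_t$, $$\begin{bmatrix}K_{t|t+1}&I\\ I&P_{t|t+1}\end{bmatrix}\succeq 0,\qquad \begin{bmatrix}Q_t^{-1}-P_t&Q_t^{-1}A_t^\top\\ A_tQ_t^{-1}&P_{t|t+1}+A_tQ_t^{-1}A_t^\top\end{bmatrix}\succeq 0 .$$ The variables of the two problems are matched by writing $V_t=B_t(\sigma(t))R_t(\sigma(t))^{-1}B_t(\sigma(t))^\top$; the constraint $V_t\in\mathsf{V}_t$ in (R) plays the role of the scheduling constraint $\sigma(t)\in\{1,\dots,N\}$ in (S). (R) is obtained from (S) by relaxing the equalities $K_{t|t+1}=P_{t|t+1}^{-1}$ and $P_t=(h_t(K_{t|t+1}))^{-1}$ to matrix inequalities.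
   Formalization: An optimal solution of (R) need not satisfy (S) literally (P_0 may be lowered freely); so from (R) to (S) its schedule is shown optimal with equal cost, and K_{t|t+1}, P_{t|t+1}, P_{t+1} agree where W̄_{t-1} is positive definite. *)

theory Defs
  imports
    "Jordan_Normal_Form.Gauss_Jordan_Elimination"
    Complex_Main
begin

text \<open>
  Matrices are those of \<^theory>\<open>Jordan_Normal_Form.Matrix\<close>, with dimensions given by carrier
  sets, because the number of columns of \<open>B t j\<close> depends on \<open>j\<close>.
\<close>

definition mat_trace :: "real mat \<Rightarrow> real" where
  "mat_trace M = (\<Sum>i<dim_row M. M $$ (i, i))"

definition sym_mat :: "nat \<Rightarrow> real mat \<Rightarrow> bool" where
  "sym_mat n M \<longleftrightarrow> M \<in> carrier_mat n n \<and> transpose_mat M = M"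

definition psd_mat :: "nat \<Rightarrow> real mat \<Rightarrow> bool" where
  "psd_mat n M \<longleftrightarrow> sym_mat n M \<and> (\<forall>v \<in> carrier_vec n. 0 \<le> v \<bullet> (M *\<^sub>v v))"

definition pd_mat :: "nat \<Rightarrow> real mat \<Rightarrow> bool" where
  "pd_mat n M \<longleftrightarrow> sym_mat n M \<and> (\<forall>v \<in> carrier_vec n. v \<noteq> 0\<^sub>v n \<longrightarrow> 0 < v \<bullet> (M *\<^sub>v v))"

text \<open>
  Meaningful for invertible matrices only; it is applied to positive definite data. For the
  matrix variables, \<open>mat_inverse P = Some K\<close> says that \<open>P\<close> is invertible with inverse \<open>K\<close>.
\<close>

definition mat_inv :: "real mat \<Rightarrow> real mat" where
  "mat_inv M = the (mat_inverse M)"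

definition BRB :: "(nat \<Rightarrow> nat \<Rightarrow> real mat) \<Rightarrow> (nat \<Rightarrow> nat \<Rightarrow> real mat) \<Rightarrow> nat \<Rightarrow> nat \<Rightarrow> real mat" where
  "BRB B R t j = B t j * mat_inv (R t j) * transpose_mat (B t j)"

definition V_set :: "nat \<Rightarrow> (nat \<Rightarrow> nat \<Rightarrow> real mat) \<Rightarrow> (nat \<Rightarrow> nat \<Rightarrow> real mat) \<Rightarrow> nat \<Rightarrow> real mat set" where
  "V_set N B R t = {BRB B R t j | j. j \<in> {1..N}}"

definition h_map :: "(nat \<Rightarrow> real mat) \<Rightarrow> (nat \<Rightarrow> real mat) \<Rightarrow> nat \<Rightarrow> real mat \<Rightarrow> real mat" where
  "h_map A Q t M = transpose_mat (A t) * M * A t + Q t"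

text \<open>\<open>Wbar A W t\<close> is $\bar W_{t-1} = A_t W_{t-1} A_t^\top$; \<open>W\<close> is indexed from $-1$.\<close>

definition Wbar :: "(nat \<Rightarrow> real mat) \<Rightarrow> (int \<Rightarrow> real mat) \<Rightarrow> nat \<Rightarrow> real mat" where
  "Wbar A W t = A t * W (int t - 1) * transpose_mat (A t)"

definition total_cost ::
  "nat \<Rightarrow> (nat \<Rightarrow> real mat) \<Rightarrow> (int \<Rightarrow> real mat) \<Rightarrow> (nat \<Rightarrow> real mat) \<Rightarrow> real" where
  "total_cost T A W Kc = (\<Sum>t<T. mat_trace (Kc t * Wbar A W t))"

text \<open>
  In both problems \<open>Kc t\<close> and \<open>Pc t\<close> stand for $K_{t|t+1}$ and $P_{t|t+1}$. Values of the
  sequences outside the index ranges (\<open>t < T\<close> for \<open>\<sigma>\<close>, \<open>Kc\<close>, \<open>Pc\<close>, \<open>V\<close>; \<open>t \<le> T\<close> for \<open>K\<close>, \<open>P\<close>) are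
  irrelevant.
\<close>

type_synonym S_point =
  "(nat \<Rightarrow> nat) \<times> (nat \<Rightarrow> real mat) \<times> (nat \<Rightarrow> real mat) \<times> (nat \<Rightarrow> real mat) \<times> (nat \<Rightarrow> real mat)"

type_synonym R_point =
  "(nat \<Rightarrow> real mat) \<times> (nat \<Rightarrow> real mat) \<times> (nat \<Rightarrow> real mat) \<times> (nat \<Rightarrow> real mat)"

definition S_feasible ::
  "nat \<Rightarrow> nat \<Rightarrow> nat \<Rightarrow> (nat \<Rightarrow> real mat) \<Rightarrow> (nat \<Rightarrow> nat \<Rightarrow> real mat) \<Rightarrow> (nat \<Rightarrow> nat \<Rightarrow> real mat) \<Rightarrow>
   (nat \<Rightarrow> real mat) \<Rightarrow> S_point \<Rightarrow> bool" where
  "S_feasible n N T A B R Q = (\<lambda>(\<sigma>, K, Kc, P, Pc).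
     (\<forall>t\<le>T. sym_mat n (K t) \<and> sym_mat n (P t) \<and> mat_inverse (P t) = Some (K t)) \<and>
     P T = mat_inv (Q T) \<and>
     (\<forall>t<T. \<sigma> t \<in> {1..N} \<and> sym_mat n (Kc t) \<and> sym_mat n (Pc t) \<and>
        mat_inverse (Pc t) = Some (Kc t) \<and>
        Pc t = P (Suc t) + BRB B R t (\<sigma> t) \<and>
        mat_inverse (P t) = Some (h_map A Q t (Kc t))))"

definition R_feasible ::
  "nat \<Rightarrow> nat \<Rightarrow> nat \<Rightarrow> (nat \<Rightarrow> real mat) \<Rightarrow> (nat \<Rightarrow> nat \<Rightarrow> real mat) \<Rightarrow> (nat \<Rightarrow> nat \<Rightarrow> real mat) \<Rightarrow>
   (nat \<Rightarrow> real mat) \<Rightarrow> R_point \<Rightarrow> bool" where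
  "R_feasible n N T A B R Q = (\<lambda>(Kc, Pc, P, V).
     (\<forall>t\<le>T. sym_mat n (P t)) \<and>
     P T = mat_inv (Q T) \<and>
     (\<forall>t<T. sym_mat n (Kc t) \<and> sym_mat n (Pc t) \<and> sym_mat n (V t) \<and>
        Pc t = P (Suc t) + V t \<and>
        V t \<in> V_set N B R t \<and>
        psd_mat (n + n) (four_block_mat (Kc t) (1\<^sub>m n) (1\<^sub>m n) (Pc t)) \<and>
        psd_mat (n + n) (four_block_mat
          (mat_inv (Q t) - P t)         (mat_inv (Q t) * transpose_mat (A t))
          (A t * mat_inv (Q t))         (Pc t + A t * mat_inv (Q t) * transpose_mat (A t)))))"

definition S_optimal ::
  "nat \<Rightarrow> nat \<Rightarrow> nat \<Rightarrow> (nat \<Rightarrow> real mat) \<Rightarrow> (nat \<Rightarrow> nat \<Rightarrow> real mat) \<Rightarrow> (nat \<Rightarrow> nat \<Rightarrow> real mat) \<Rightarrow>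
   (nat \<Rightarrow> real mat) \<Rightarrow> (int \<Rightarrow> real mat) \<Rightarrow> S_point \<Rightarrow> bool" where
  "S_optimal n N T A B R Q W =
     is_arg_min (\<lambda>(\<sigma>, K, Kc, P, Pc). total_cost T A W Kc) (S_feasible n N T A B R Q)"

definition R_optimal ::
  "nat \<Rightarrow> nat \<Rightarrow> nat \<Rightarrow> (nat \<Rightarrow> real mat) \<Rightarrow> (nat \<Rightarrow> nat \<Rightarrow> real mat) \<Rightarrow> (nat \<Rightarrow> nat \<Rightarrow> real mat) \<Rightarrow>
   (nat \<Rightarrow> real mat) \<Rightarrow> (int \<Rightarrow> real mat) \<Rightarrow> R_point \<Rightarrow> bool" where
  "R_optimal n N T A B R Q W =
     is_arg_min (\<lambda>(Kc, Pc, P, V). total_cost T A W Kc) (R_feasible n N T A B R Q)"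

text \<open>The correspondence between the schedule of one problem and the variables \<open>V\<close> of the other.\<close>

definition matched ::
  "nat \<Rightarrow> nat \<Rightarrow> (nat \<Rightarrow> nat \<Rightarrow> real mat) \<Rightarrow> (nat \<Rightarrow> nat \<Rightarrow> real mat) \<Rightarrow>
   (nat \<Rightarrow> nat) \<Rightarrow> (nat \<Rightarrow> real mat) \<Rightarrow> bool" where
  "matched N T B R \<sigma> V \<longleftrightarrow> (\<forall>t<T. \<sigma> t \<in> {1..N} \<and> V t = BRB B R t (\<sigma> t))"

end

theory Submission
  imports Defs "Jordan_Normal_Form.Determinant"
begin

text \<open>
  Completing squares, the second matrix inequality of (R) says
  $x^\top P_t x \le (x + A_t^\top y)^\top Q_t^{-1} (x + A_t^\top y) + y^\top P_{t|t+1} y$ for all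
  $x, y$, and the minimum of the right-hand side over $y$ is $x^\top h_t(P_{t|t+1}^{-1})^{-1} x$.
  Backward induction therefore shows that, for a fixed schedule, the solution of the Riccati
  recursion in (S) is feasible for (R), has the largest $P_t$ and $P_{t|t+1}$, and by the first
  inequality has the smallest $K_{t|t+1}$. As the trace of a product of positive semidefinite
  matrices is nonnegative, it minimizes every summand of the cost; a positive definite
  $\bar W_{t-1}$ makes the minimizer unique.
\<close>

section \<open>Quadratic forms of symmetric matrices\<close>

text \<open>The obstacle is that an optimal point of (R) need not be a point of (S). Where
  \<open>Wbar A W t\<close> is singular the cost does not see all of \<open>Kc t\<close>, and
  \<open>P 0\<close> never enters the cost, so replacing it by a smaller matrix in the semidefinite
  order keeps feasibility and optimality. Optimality therefore passes from (R) to (S) through the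
  schedule, with the matrices recomputed by the exact recursion. Relaxed matrices \<open>P t\<close>
  may moreover be singular or indefinite. For this reason no inverse or Schur complement of a
  relaxed variable is ever formed: each matrix inequality is used as a family of scalar inequalities
  in \<open>x\<close> and \<open>y\<close>, and each comparison evaluates it at vectors taken from
  the exact solution.\<close>

lemma sym_mat_carrier [simp]: "sym_mat n M \<Longrightarrow> M \<in> carrier_mat n n"
  by (simp add: sym_mat_def)

lemma pd_imp_sym [simp]: "pd_mat n M \<Longrightarrow> sym_mat n M"
  by (simp add: pd_mat_def)

lemma psd_imp_sym [simp]: "psd_mat n M \<Longrightarrow> sym_mat n M"
  by (simp add: psd_mat_def)

lemma sym_mat_add: "sym_mat n M \<Longrightarrow> sym_mat n N \<Longrightarrow> sym_mat n (M + N)"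
  by (auto simp: sym_mat_def transpose_add)

lemma sym_mat_minus: "sym_mat n M \<Longrightarrow> sym_mat n N \<Longrightarrow> sym_mat n (M - N)"
  by (auto simp: sym_mat_def transpose_minus)

lemma sym_mat_congruence:
  assumes "sym_mat n M" "C \<in> carrier_mat k n"
  shows "sym_mat k (C * M * transpose_mat C)"
proof -
  have M: "M \<in> carrier_mat n n" "transpose_mat M = M" using assms by (simp_all add: sym_mat_def)
  have Ct: "transpose_mat C \<in> carrier_mat n k" using assms by simp
  have CM: "C * M \<in> carrier_mat k n" using assms M by simp
  have "transpose_mat (C * M * transpose_mat C) = C * (M * transpose_mat C)"
    using transpose_mult[OF CM Ct] transpose_mult[OF assms(2) M(1)] M by simp
  also have "\<dots> = C * M * transpose_mat C"
    by (rule assoc_mult_mat[OF assms(2) M(1) Ct, symmetric])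
  finally show ?thesis using CM Ct by (simp add: sym_mat_def)
qed

lemma sym_mat_index: "sym_mat n M \<Longrightarrow> i < n \<Longrightarrow> j < n \<Longrightarrow> M $$ (i, j) = M $$ (j, i)"
  unfolding sym_mat_def by (metis carrier_matD index_transpose_mat(1))

lemma sym_form_commute:
  assumes "sym_mat n M" "x \<in> carrier_vec n" "y \<in> carrier_vec n"
  shows "x \<bullet> (M *\<^sub>v y) = y \<bullet> (M *\<^sub>v x)"
proof -
  have "x \<bullet> (M *\<^sub>v y) = (M *\<^sub>v x) \<bullet> y"
    using assms transpose_vec_mult_scalar[of M n n y x] by (simp add: sym_mat_def)
  also have "\<dots> = y \<bullet> (M *\<^sub>v x)"
    by (rule comm_scalar_prod[of _ n]) (use assms in \<open>auto intro!: mult_mat_vec_carrier[of _ n n]\<close>)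
  finally show ?thesis .
qed

lemma form_lincomb:
  fixes s t :: real
  assumes M: "sym_mat n M" and x: "x \<in> carrier_vec n" and y: "y \<in> carrier_vec n"
  shows "(s \<cdot>\<^sub>v x + t \<cdot>\<^sub>v y) \<bullet> (M *\<^sub>v (s \<cdot>\<^sub>v x + t \<cdot>\<^sub>v y)) =
    s\<^sup>2 * (x \<bullet> (M *\<^sub>v x)) + 2 * s * t * (x \<bullet> (M *\<^sub>v y)) + t\<^sup>2 * (y \<bullet> (M *\<^sub>v y))"
proof -
  have [simp]: "M *\<^sub>v x \<in> carrier_vec n" "M *\<^sub>v y \<in> carrier_vec n"
    using M x y by (auto intro!: mult_mat_vec_carrier[of _ n n])
  have "M *\<^sub>v (s \<cdot>\<^sub>v x + t \<cdot>\<^sub>v y) = s \<cdot>\<^sub>v (M *\<^sub>v x) + t \<cdot>\<^sub>v (M *\<^sub>v y)"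
    using M x y by (simp add: mult_add_distrib_mat_vec[of _ n n] mult_mat_vec[of _ n n])
  then show ?thesis
    using x y sym_form_commute[OF M y x]
    by (simp add: add_scalar_prod_distrib[of _ n] scalar_prod_add_distrib[of _ n]
        smult_scalar_prod_distrib[of _ n] scalar_prod_smult_distrib[of _ n])
       (simp add: algebra_simps power2_eq_square)
qed

lemma form_add:
  fixes M :: "real mat"
  assumes "sym_mat n M" "x \<in> carrier_vec n" "y \<in> carrier_vec n"
  shows "(x + y) \<bullet> (M *\<^sub>v (x + y)) =
    x \<bullet> (M *\<^sub>v x) + 2 * (x \<bullet> (M *\<^sub>v y)) + y \<bullet> (M *\<^sub>v y)"
  using form_lincomb[OF assms, of 1 1] assms by simp

lemma scalar_prod_uminus_carrier:
  fixes x y :: "real vec"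
  assumes "x \<in> carrier_vec n" "y \<in> carrier_vec n"
  shows "x \<bullet> (- y) = - (x \<bullet> y)" "(- x) \<bullet> y = - (x \<bullet> y)"
  using carrier_vecD[OF assms(1)] carrier_vecD[OF assms(2)]
  by (simp_all only: scalar_prod_uminus_left scalar_prod_uminus_right)

lemma mult_mat_vec_uminus:
  fixes M :: "real mat"
  assumes "M \<in> carrier_mat k n" "x \<in> carrier_vec n"
  shows "M *\<^sub>v (- x) = - (M *\<^sub>v x)"
proof (rule eq_vecI)
  fix i assume "i < dim_vec (- (M *\<^sub>v x))"
  then have "i < k" using assms by simp
  then show "(M *\<^sub>v (- x)) $ i = (- (M *\<^sub>v x)) $ i"
    using assms scalar_prod_uminus_carrier(1)[of "row M i" n x] by auto
qed simp

lemma form_uminus: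
  fixes M :: "real mat"
  assumes "M \<in> carrier_mat n n" "x \<in> carrier_vec n"
  shows "(- x) \<bullet> (M *\<^sub>v (- x)) = x \<bullet> (M *\<^sub>v x)"
  using mult_mat_vec_uminus[OF assms] mult_mat_vec_carrier[OF assms] assms(2)
  by (simp add: scalar_prod_uminus_carrier[of _ n])

lemma form_matrix_add:
  fixes M N :: "real mat"
  assumes "M \<in> carrier_mat n n" "N \<in> carrier_mat n n" "x \<in> carrier_vec n" "y \<in> carrier_vec n"
  shows "x \<bullet> ((M + N) *\<^sub>v y) = x \<bullet> (M *\<^sub>v y) + x \<bullet> (N *\<^sub>v y)"
  using assms
  by (simp add: add_mult_distrib_mat_vec[of _ n n] scalar_prod_add_distrib[of _ n] mult_mat_vec_carrier[of _ n n])

lemma form_matrix_minus: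
  fixes M N :: "real mat"
  assumes "M \<in> carrier_mat n n" "N \<in> carrier_mat n n" "x \<in> carrier_vec n" "y \<in> carrier_vec n"
  shows "x \<bullet> ((M - N) *\<^sub>v y) = x \<bullet> (M *\<^sub>v y) - x \<bullet> (N *\<^sub>v y)"
  using assms
  by (simp add: minus_mult_distrib_mat_vec[of _ n n] scalar_prod_minus_distrib[of _ n] mult_mat_vec_carrier[of _ n n])

lemma form_congruence:
  fixes M :: "real mat"
  assumes M: "M \<in> carrier_mat n n" and C: "C \<in> carrier_mat k n"
    and x: "x \<in> carrier_vec k" and y: "y \<in> carrier_vec k"
  shows "x \<bullet> ((C * M * transpose_mat C) *\<^sub>v y) =
    (transpose_mat C *\<^sub>v x) \<bullet> (M *\<^sub>v (transpose_mat C *\<^sub>v y))"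
proof -
  have Ct: "transpose_mat C \<in> carrier_mat n k" using C by simp
  have u: "transpose_mat C *\<^sub>v y \<in> carrier_vec n" using Ct y by (rule mult_mat_vec_carrier)
  have "(C * M * transpose_mat C) *\<^sub>v y = C *\<^sub>v (M *\<^sub>v (transpose_mat C *\<^sub>v y))"
    using M C Ct y u by (simp add: assoc_mult_mat_vec[of _ k n _ n] assoc_mult_mat_vec[of _ k n _ k])
  then show ?thesis
    using transpose_vec_mult_scalar[OF C _ x] M u by (metis mult_mat_vec_carrier)
qed

lemma form_unit_vec:
  fixes M :: "real mat"
  assumes "M \<in> carrier_mat n n" "i < n" "j < n"
  shows "unit_vec n i \<bullet> (M *\<^sub>v unit_vec n j) = M $$ (i, j)"
  using assms
  by (simp add: scalar_prod_left_unit[of _ n] mult_mat_vec_carrier[of _ n n] scalar_prod_right_unit)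

text \<open>Polarization: the forms at \<open>e_i\<close>, \<open>e_j\<close> and
  \<open>e_i + e_j\<close> determine the entry at \<open>(i, j)\<close>. In the uniqueness argument
  this turns opposite quadratic inequalities into equality of matrices.\<close>

lemma sym_mat_eqI_form:
  assumes M: "sym_mat n M" and N: "sym_mat n N"
    and eq: "\<And>v. v \<in> carrier_vec n \<Longrightarrow> v \<bullet> (M *\<^sub>v v) = v \<bullet> (N *\<^sub>v v)"
  shows "M = N"
proof (rule eq_matI)
  have carr: "M \<in> carrier_mat n n" "N \<in> carrier_mat n n" using M N by simp_all
  then show "dim_row M = dim_row N" "dim_col M = dim_col N" by auto
  fix i j assume "i < dim_row N" "j < dim_col N"
  then have ij: "i < n" "j < n" using carr by auto
  let ?e = "unit_vec n :: nat \<Rightarrow> real vec"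
  have "?e i \<bullet> (M *\<^sub>v ?e j) = ?e i \<bullet> (N *\<^sub>v ?e j)"
    using eq[of "?e i + ?e j"] eq[of "?e i"] eq[of "?e j"]
      form_add[OF M, of "?e i" "?e j"] form_add[OF N, of "?e i" "?e j"] by simp
  then show "M $$ (i, j) = N $$ (i, j)"
    using ij carr by (simp only: form_unit_vec)
qed

text \<open>On the span of \<open>x\<close> and \<open>y\<close> the form is a nonnegative binary
  quadratic form, so its discriminant is not positive. Semidefiniteness allows
  \<open>?c = 0\<close>, which needs its own argument.\<close>

lemma psd_cauchy_schwarz:
  assumes M: "psd_mat n M" and x: "x \<in> carrier_vec n" and y: "y \<in> carrier_vec n"
  shows "(x \<bullet> (M *\<^sub>v y))\<^sup>2 \<le> (x \<bullet> (M *\<^sub>v x)) * (y \<bullet> (M *\<^sub>v y))"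
proof -
  let ?a = "x \<bullet> (M *\<^sub>v x)" and ?b = "x \<bullet> (M *\<^sub>v y)" and ?c = "y \<bullet> (M *\<^sub>v y)"
  have nonneg: "0 \<le> s\<^sup>2 * ?a + 2 * s * t * ?b + t\<^sup>2 * ?c" for s t
  proof -
    have "0 \<le> (s \<cdot>\<^sub>v x + t \<cdot>\<^sub>v y) \<bullet> (M *\<^sub>v (s \<cdot>\<^sub>v x + t \<cdot>\<^sub>v y))"
      using M x y by (simp add: psd_mat_def)
    then show ?thesis using form_lincomb[of n M x y s t] M x y by simp
  qed
  have c0: "0 \<le> ?c" using M y by (simp add: psd_mat_def)
  show ?thesis
  proof (cases "?c = 0")
    case True
    have "?b = 0"
    proof (rule ccontr)
      assume "?b \<noteq> 0"
      \<comment> \<open>With \<open>?c = 0\<close> the form is affine in the second coefficient;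
        this value makes it equal to -1.\<close>
      then show False
        using nonneg[of 1 "- (?a + 1) / (2 * ?b)"] True by (simp add: field_simps)
    qed
    then show ?thesis using True by simp
  next
    case False
    have "0 \<le> ?c * (?a * ?c - ?b\<^sup>2)"
      using nonneg[of ?c "- ?b"] by (simp add: algebra_simps power2_eq_square)
    then show ?thesis using False c0 by (simp add: zero_le_mult_iff)
  qed
qed

section \<open>Inverses of positive definite matrices\<close>

lemma mat_inverse_SomeD:
  assumes "M \<in> carrier_mat n n" "mat_inverse M = Some K"
  shows "M * K = 1\<^sub>m n" "K * M = 1\<^sub>m n" "K \<in> carrier_mat n n"
  using mat_inverse(2)[OF assms] by auto

lemma mat_inverse_mult_vec:
  assumes "M \<in> carrier_mat n n" "mat_inverse M = Some K" "v \<in> carrier_vec n"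
  shows "M *\<^sub>v (K *\<^sub>v v) = v" "K *\<^sub>v (M *\<^sub>v v) = v"
  using mat_inverse_SomeD[OF assms(1,2)] assms
  by (simp_all flip: assoc_mult_mat_vec[of _ n n _ n])

text \<open>A right inverse is enough: multiplicativity of \<open>det\<close> makes \<open>M\<close>
  invertible, and the two-sided inverse returned by \<open>mat_inverse\<close> must then agree with
  \<open>K\<close>.\<close>

lemma mat_inverse_eqI:
  assumes M: "M \<in> carrier_mat n n" and K: "K \<in> carrier_mat n n" and MK: "M * K = 1\<^sub>m n"
  shows "mat_inverse M = Some (K :: real mat)"
proof -
  have "det M \<noteq> 0" using det_mult[OF M K] MK by auto
  then obtain K' where K': "mat_inverse M = Some K'"
    using mat_inverse(1)[OF M, where b = "()"] det_non_zero_imp_unit[OF M] by fastforce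
  have "K' = K' * (M * K)" using mat_inverse_SomeD[OF M K'] MK by simp
  also have "\<dots> = K" using mat_inverse_SomeD[OF M K'] M K by (simp flip: assoc_mult_mat)
  finally show ?thesis using K' by simp
qed

lemma mat_inverse_sym:
  assumes "M \<in> carrier_mat n n" "mat_inverse M = Some K"
  shows "mat_inverse K = Some (M :: real mat)"
  using mat_inverse_SomeD[OF assms] assms by (intro mat_inverse_eqI[of _ n])

text \<open>A kernel vector would make the form of \<open>M\<close> vanish, so the inverse exists.
  It is symmetric because its transpose is an inverse too, and its form at \<open>v\<close> is the
  form of \<open>M\<close> at \<open>K v\<close>.\<close>

lemma pd_mat_inverse:
  assumes M: "pd_mat n M"
  obtains K where "mat_inverse M = Some K" "pd_mat n K"
proof -
  have Mc: "M \<in> carrier_mat n n" using M by simp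
  have "det M \<noteq> 0"
  proof
    assume "det M = 0"
    then obtain v where v: "v \<in> carrier_vec n" "v \<noteq> 0\<^sub>v n" "M *\<^sub>v v = 0\<^sub>v n"
      using det_0_iff_vec_prod_zero_field[OF Mc] by auto
    then have "0 < v \<bullet> (M *\<^sub>v v)" using M unfolding pd_mat_def by blast
    then show False using v by simp
  qed
  then obtain K where K: "mat_inverse M = Some K"
    using mat_inverse(1)[OF Mc, where b = "()"] det_non_zero_imp_unit[OF Mc] by fastforce
  note KM = mat_inverse_SomeD[OF Mc K]
  have Kt: "transpose_mat K \<in> carrier_mat n n" using KM by simp
  have "M * transpose_mat K = transpose_mat (K * M)"
    using transpose_mult[OF KM(3) Mc] M by (simp add: pd_mat_def sym_mat_def)
  then have "mat_inverse M = Some (transpose_mat K)"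
    using KM Kt by (intro mat_inverse_eqI[OF Mc]) simp_all
  then have "sym_mat n K" using K KM by (simp add: sym_mat_def)
  moreover have "0 < v \<bullet> (K *\<^sub>v v)" if v: "v \<in> carrier_vec n" "v \<noteq> 0\<^sub>v n" for v
  proof -
    let ?u = "K *\<^sub>v v"
    have u: "?u \<in> carrier_vec n" using KM v by simp
    have Mu: "M *\<^sub>v ?u = v" by (rule mat_inverse_mult_vec[OF Mc K v(1)])
    have "M *\<^sub>v 0\<^sub>v n = 0\<^sub>v n" using Mc by (intro eq_vecI) auto
    then have "?u \<noteq> 0\<^sub>v n" using Mu v by metis
    then have "0 < ?u \<bullet> (M *\<^sub>v ?u)" using M u unfolding pd_mat_def by blast
    then show ?thesis using Mu comm_scalar_prod[OF u v(1)] by simp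
  qed
  ultimately have "pd_mat n K" by (simp add: pd_mat_def)
  with K that show thesis by blast
qed

lemma pd_mat_inv:
  assumes "pd_mat n M"
  shows "mat_inverse M = Some (mat_inv M)" "pd_mat n (mat_inv M)"
proof -
  obtain K where "mat_inverse M = Some K" "pd_mat n K" using pd_mat_inverse[OF assms] .
  then show "mat_inverse M = Some (mat_inv M)" "pd_mat n (mat_inv M)"
    by (simp_all add: mat_inv_def)
qed

lemma pd_mat_inverseD:
  assumes "pd_mat n M" "mat_inverse M = Some K"
  shows "pd_mat n K"
  using pd_mat_inv[OF assms(1)] assms(2) by simp

lemma pd_imp_psd: "pd_mat n M \<Longrightarrow> psd_mat n M"
  unfolding pd_mat_def psd_mat_def sym_mat_def
  by (metis less_eq_real_def mult_mat_vec_carrier scalar_prod_left_zero)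

lemma pd_psd_add:
  assumes "pd_mat n M" "psd_mat n N"
  shows "pd_mat n (M + N)"
proof -
  have "0 < v \<bullet> ((M + N) *\<^sub>v v)" if v: "v \<in> carrier_vec n" "v \<noteq> 0\<^sub>v n" for v
  proof -
    have "0 < v \<bullet> (M *\<^sub>v v)" "0 \<le> v \<bullet> (N *\<^sub>v v)"
      using assms v unfolding pd_mat_def psd_mat_def by blast+
    then show ?thesis using form_matrix_add[of M n N v v] assms v(1) by simp
  qed
  moreover have "sym_mat n (M + N)" using assms by (intro sym_mat_add) simp_all
  ultimately show ?thesis unfolding pd_mat_def by blast
qed

lemma psd_congruence:
  assumes "psd_mat n M" "C \<in> carrier_mat k n"
  shows "psd_mat k (C * M * transpose_mat C)"
  using assms sym_mat_congruence[of n M C k]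
  by (auto simp: psd_mat_def form_congruence[of _ n] mult_mat_vec_carrier[of _ n k])

text \<open>The right-hand side is the form of \<open>M\<close> at \<open>a + K b\<close>, with
  equality exactly at \<open>a = - K b\<close>. With the weights \<open>Q t\<close>,
  \<open>Pc t\<close> and \<open>Kc t\<close> this supplies both matrix inequalities of (R) for
  exact points.\<close>

lemma young_inverse_form:
  assumes M: "pd_mat n M" and K: "mat_inverse M = Some K"
    and a: "a \<in> carrier_vec n" and b: "b \<in> carrier_vec n"
  shows "0 \<le> a \<bullet> (M *\<^sub>v a) + 2 * (a \<bullet> b) + b \<bullet> (K *\<^sub>v b)"
proof -
  have Mc: "M \<in> carrier_mat n n" using M by simp
  let ?u = "K *\<^sub>v b"
  have u: "?u \<in> carrier_vec n" using mat_inverse_SomeD[OF Mc K] b by simp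
  have Mu: "M *\<^sub>v ?u = b" by (rule mat_inverse_mult_vec[OF Mc K b])
  have "0 \<le> (a + ?u) \<bullet> (M *\<^sub>v (a + ?u))"
    using pd_imp_psd[OF M] a u by (simp add: psd_mat_def)
  then show ?thesis
    using form_add[OF pd_imp_sym[OF M] a u] Mu comm_scalar_prod[OF u b] by simp
qed

section \<open>Traces of products\<close>

lemma mat_trace_mult:
  assumes "M \<in> carrier_mat n n" "W \<in> carrier_mat n n"
  shows "mat_trace (M * W) = (\<Sum>i<n. \<Sum>j<n. M $$ (i, j) * W $$ (j, i))"
  using assms by (auto simp: mat_trace_def scalar_prod_def lessThan_atLeast0 intro!: sum.cong)

lemma mat_trace_minus_mult:
  assumes "M \<in> carrier_mat n n" "N \<in> carrier_mat n n" "W \<in> carrier_mat n n"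
  shows "mat_trace ((M - N) * W) = mat_trace (M * W) - mat_trace (N * W)"
proof -
  have MN: "M - N \<in> carrier_mat n n" using assms(2) by (rule minus_carrier_mat)
  show ?thesis
    using assms unfolding mat_trace_mult[OF MN assms(3)] mat_trace_mult[OF assms(1,3)]
      mat_trace_mult[OF assms(2,3)] sum_subtractf[symmetric]
    by (auto simp: left_diff_distrib intro!: sum.cong)
qed

text \<open>This is \<open>W - c v v^T\<close>, written entrywise because traces and forms are
  compared as double sums over indices.\<close>

definition rank_one_downdate :: "nat \<Rightarrow> real mat \<Rightarrow> real \<Rightarrow> real vec \<Rightarrow> real mat" where
  "rank_one_downdate n W c v = mat n n (\<lambda>(i, j). W $$ (i, j) - c * (v $ i * v $ j))"

lemma rank_one_downdate_carrier [simp]: "rank_one_downdate n W c v \<in> carrier_mat n n"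
  by (simp add: rank_one_downdate_def)

lemma form_index:
  fixes M :: "real mat"
  assumes "M \<in> carrier_mat n n" "x \<in> carrier_vec n" "y \<in> carrier_vec n"
  shows "x \<bullet> (M *\<^sub>v y) = (\<Sum>i<n. \<Sum>j<n. M $$ (i, j) * (x $ i * y $ j))"
proof -
  have "x \<bullet> (M *\<^sub>v y) = (\<Sum>i<n. x $ i * (\<Sum>j<n. M $$ (i, j) * y $ j))"
    using assms by (auto simp: scalar_prod_def lessThan_atLeast0 intro!: sum.cong)
  then show ?thesis by (simp add: sum_distrib_left mult.left_commute)
qed

lemma form_rank_one_downdate:
  assumes W: "W \<in> carrier_mat n n" and v: "v \<in> carrier_vec n" and x: "x \<in> carrier_vec n"
  shows "x \<bullet> (rank_one_downdate n W c v *\<^sub>v x) = x \<bullet> (W *\<^sub>v x) - c * (v \<bullet> x)\<^sup>2"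
proof -
  have "c * (v \<bullet> x)\<^sup>2 = (\<Sum>i<n. \<Sum>j<n. c * (v $ i * v $ j) * (x $ i * x $ j))"
    using x unfolding power2_eq_square scalar_prod_def
    by (simp add: sum_product sum_distrib_left lessThan_atLeast0 ac_simps)
  then show ?thesis
    unfolding form_index[OF rank_one_downdate_carrier x x] form_index[OF W x x]
    by (auto simp: rank_one_downdate_def left_diff_distrib simp flip: sum_subtractf intro!: sum.cong)
qed

lemma mat_trace_rank_one_downdate:
  assumes M: "M \<in> carrier_mat n n" and W: "W \<in> carrier_mat n n" and v: "v \<in> carrier_vec n"
  shows "mat_trace (M * rank_one_downdate n W c v) = mat_trace (M * W) - c * (v \<bullet> (M *\<^sub>v v))"
  unfolding mat_trace_mult[OF M rank_one_downdate_carrier] mat_trace_mult[OF M W] form_index[OF M v v]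
  by (auto simp: rank_one_downdate_def sum_distrib_left algebra_simps
      simp flip: sum_subtractf intro!: sum.cong)

lemma psd_rank_one_downdate:
  assumes W: "sym_mat n W" and v: "v \<in> carrier_vec n"
    and le: "\<And>x. x \<in> carrier_vec n \<Longrightarrow> c * (v \<bullet> x)\<^sup>2 \<le> x \<bullet> (W *\<^sub>v x)"
  shows "psd_mat n (rank_one_downdate n W c v)"
proof -
  have "sym_mat n (rank_one_downdate n W c v)"
    using sym_mat_index[OF W]
    by (auto simp: sym_mat_def rank_one_downdate_def mult.commute intro!: eq_matI)
  then show ?thesis
    using le W v by (simp add: psd_mat_def form_rank_one_downdate)
qed

text \<open>Symmetric Gaussian elimination: subtracting the rank-one matrix of column \<open>k\<close>, scaled by the
  pivot, keeps \<open>W\<close> positive semidefinite and clears one more row.\<close>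

lemma mat_trace_psd_mult_nonneg_aux:
  assumes M: "psd_mat n M" and "k \<le> n" "psd_mat n W"
    and "\<And>i j. i < k \<Longrightarrow> j < n \<Longrightarrow> W $$ (i, j) = 0"
  shows "0 \<le> mat_trace (M * W)"
  using assms(2-)
\<comment> \<open>\<open>k\<close> counts the leading rows of \<open>W\<close> already cleared. The
  induction runs downward from \<open>n\<close>, where \<open>W\<close> is zero, and
  \<open>W\<close> must vary because each step changes it.\<close>
proof (induction k arbitrary: W rule: inc_induct)
  case base
  then show ?case using M by (simp add: mat_trace_mult[of _ n] sum_nonneg)
next
  case (step k)
  have W: "sym_mat n W" "W \<in> carrier_mat n n" using step.prems by simp_all
  let ?e = "unit_vec n k :: real vec"
  have pivot: "?e \<bullet> (W *\<^sub>v ?e) = W $$ (k, k)"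
    using W step.hyps by (simp add: form_unit_vec)
  have col: "(W *\<^sub>v ?e) $ i = W $$ (i, k)" if "i < n" for i
    using carrier_matD[OF W(2)] step.hyps that by (simp add: scalar_prod_right_unit)
  have v: "W *\<^sub>v ?e \<in> carrier_vec n" using W(2) by simp
  have cs: "((W *\<^sub>v ?e) \<bullet> x)\<^sup>2 \<le> (x \<bullet> (W *\<^sub>v x)) * W $$ (k, k)" if x: "x \<in> carrier_vec n" for x
    using psd_cauchy_schwarz[OF step.prems(1) x, of ?e] comm_scalar_prod[OF v x] pivot by simp
  show ?case
  proof (cases "W $$ (k, k) = 0")
    \<comment> \<open>At a zero pivot Cauchy-Schwarz makes the whole column vanish, so row
      \<open>k\<close> is already clear and \<open>W\<close> itself can be passed on.\<close>
    case True
    have "W $$ (k, j) = 0" if j: "j < n" for j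
    proof -
      have "(W $$ (j, k))\<^sup>2 \<le> 0"
        using cs[of "unit_vec n j"] True j v col[OF j] by (simp add: scalar_prod_right_unit)
      then show ?thesis using sym_mat_index[OF W(1)] j step.hyps by simp
    qed
    then show ?thesis
      using step.prems by (intro step.IH) (auto simp: less_Suc_eq)
  next
    case False
    have "0 \<le> W $$ (k, k)" using step.prems(1) pivot by (metis psd_mat_def unit_vec_carrier)
    with False have pos: "0 < W $$ (k, k)" by simp
    let ?c = "1 / W $$ (k, k)" and ?v = "W *\<^sub>v ?e"
    let ?W = "rank_one_downdate n W ?c ?v"
    have "psd_mat n ?W"
      using cs pos by (intro psd_rank_one_downdate[OF W(1) v]) (simp add: field_simps)
    moreover have "?W $$ (i, j) = 0" if "i < Suc k" "j < n" for i j
    proof (cases "i = k")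
      case True
      then show ?thesis using that step.hyps col pos sym_mat_index[OF W(1), of k j]
        by (simp add: rank_one_downdate_def)
    next
      \<comment> \<open>For \<open>i < k\<close> the pivot column is zero in row \<open>i\<close>,
        so the subtraction does not refill cleared rows.\<close>
      case False
      then show ?thesis using that step.hyps col step.prems(2)[of i k] step.prems(2)[of i j]
        by (simp add: rank_one_downdate_def)
    qed
    ultimately have "0 \<le> mat_trace (M * ?W)" by (rule step.IH)
    moreover have "0 \<le> ?c * (?v \<bullet> (M *\<^sub>v ?v))"
      using M v pos by (simp add: psd_mat_def)
    ultimately show ?thesis
      using mat_trace_rank_one_downdate[of M n W ?v ?c] M W v by simp
  qed
qed

lemma mat_trace_psd_mult_nonneg:
  assumes "psd_mat n M" "psd_mat n W"
  shows "0 \<le> mat_trace (M * W)"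
  using mat_trace_psd_mult_nonneg_aux[OF assms(1), of 0 W] assms(2) by simp

text \<open>A positive definite \<open>W\<close> dominates a positive multiple of every rank-one matrix.\<close>

lemma mat_trace_pd_mult_zero:
  assumes M: "psd_mat n M" and W: "pd_mat n W" and tr: "mat_trace (M * W) = 0"
    and v: "v \<in> carrier_vec n"
  shows "v \<bullet> (M *\<^sub>v v) = 0"
proof (cases "v = 0\<^sub>v n")
  case True
  then show ?thesis using M by (simp add: mult_mat_vec_carrier[of _ n n])
next
  case False
  obtain K where K: "mat_inverse W = Some K" "pd_mat n K" using pd_mat_inverse[OF W] .
  have Wc: "W \<in> carrier_mat n n" using W by simp
  let ?u = "K *\<^sub>v v" and ?d = "v \<bullet> (K *\<^sub>v v)"
  have u: "?u \<in> carrier_vec n" using mat_inverse_SomeD(3)[OF Wc K(1)] v by simp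
  have Wu: "W *\<^sub>v ?u = v" by (rule mat_inverse_mult_vec[OF Wc K(1) v])
  have d: "0 < ?d" using K(2) v False unfolding pd_mat_def by blast
  \<comment> \<open>The constant \<open>1 / ?d\<close> is the largest possible. The bound is
    Cauchy-Schwarz for \<open>W\<close> at \<open>x\<close> and \<open>?u\<close>: \<open>W\<close>
    maps \<open>?u\<close> to \<open>v\<close>, so its form at \<open>?u\<close> is
    \<open>?d\<close>, and equality holds at \<open>x = ?u\<close>.\<close>
  have "1 / ?d * (v \<bullet> x)\<^sup>2 \<le> x \<bullet> (W *\<^sub>v x)" if x: "x \<in> carrier_vec n" for x
    using psd_cauchy_schwarz[OF pd_imp_psd[OF W] x u] Wu comm_scalar_prod[OF x v]
      comm_scalar_prod[OF u v] d by (simp add: field_simps)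
  then have "psd_mat n (rank_one_downdate n W (1 / ?d) v)"
    using W v by (intro psd_rank_one_downdate) simp_all
  from mat_trace_psd_mult_nonneg[OF M this]
  have "0 \<le> mat_trace (M * W) - 1 / ?d * (v \<bullet> (M *\<^sub>v v))"
    using mat_trace_rank_one_downdate[of M n W v "1 / ?d"] M Wc v by simp
  then have "v \<bullet> (M *\<^sub>v v) \<le> 0" using tr d by (simp add: field_simps)
  then show ?thesis using M v by (simp add: psd_mat_def order_antisym)
qed

section \<open>The linear matrix inequalities as quadratic inequalities\<close>

lemma psd_four_block_iff:
  assumes D1: "sym_mat n D1" and D2: "sym_mat n D2" and C: "C \<in> carrier_mat n n"
  shows "psd_mat (n + n) (four_block_mat D1 C (transpose_mat C) D2) \<longleftrightarrow>
    (\<forall>x \<in> carrier_vec n. \<forall>y \<in> carrier_vec n.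
      0 \<le> x \<bullet> (D1 *\<^sub>v x) + 2 * (x \<bullet> (C *\<^sub>v y)) + y \<bullet> (D2 *\<^sub>v y))"
    (is "psd_mat _ ?F \<longleftrightarrow> ?rhs")
proof -
  have carr: "D1 \<in> carrier_mat n n" "D2 \<in> carrier_mat n n" "transpose_mat C \<in> carrier_mat n n"
    using D1 D2 C by simp_all
  have F: "sym_mat (n + n) ?F"
    using D1 D2 transpose_four_block_mat[OF carr(1) C carr(3,2)] carr
    by (simp add: sym_mat_def)
  have form: "(x @\<^sub>v y) \<bullet> (?F *\<^sub>v (x @\<^sub>v y)) =
      x \<bullet> (D1 *\<^sub>v x) + 2 * (x \<bullet> (C *\<^sub>v y)) + y \<bullet> (D2 *\<^sub>v y)"
    if x: "x \<in> carrier_vec n" and y: "y \<in> carrier_vec n" for x y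
  proof -
    have vecs: "D1 *\<^sub>v x \<in> carrier_vec n" "C *\<^sub>v y \<in> carrier_vec n"
      "transpose_mat C *\<^sub>v x \<in> carrier_vec n" "D2 *\<^sub>v y \<in> carrier_vec n"
      using carr C x y by (auto intro!: mult_mat_vec_carrier[of _ n n])
    have "?F *\<^sub>v (x @\<^sub>v y) = (D1 *\<^sub>v x + C *\<^sub>v y) @\<^sub>v (transpose_mat C *\<^sub>v x + D2 *\<^sub>v y)"
      by (rule four_block_mat_mult_vec[OF carr(1) C carr(3,2) x y])
    moreover have "y \<bullet> (transpose_mat C *\<^sub>v x) = x \<bullet> (C *\<^sub>v y)"
      using transpose_vec_mult_scalar[OF C y x] comm_scalar_prod[OF vecs(3) y] by simp
    ultimately show ?thesis
      using x y vecs
      by (simp add: scalar_prod_append[of _ n _ n] scalar_prod_add_distrib[of _ n])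
  qed
  show ?thesis
  proof
    assume "psd_mat (n + n) ?F"
    then show ?rhs using form by (metis append_carrier_vec psd_mat_def)
  next
    assume rhs: ?rhs
    have "0 \<le> v \<bullet> (?F *\<^sub>v v)" if v: "v \<in> carrier_vec (n + n)" for v
      using form[of "vec_first v n" "vec_last v n"] rhs v by simp
    then show "psd_mat (n + n) ?F" using F by (simp add: psd_mat_def)
  qed
qed

lemma psd_inverse_block_iff:
  assumes "sym_mat n K" "sym_mat n P"
  shows "psd_mat (n + n) (four_block_mat K (1\<^sub>m n) (1\<^sub>m n) P) \<longleftrightarrow>
    (\<forall>x \<in> carrier_vec n. \<forall>y \<in> carrier_vec n.
      0 \<le> x \<bullet> (K *\<^sub>v x) + 2 * (x \<bullet> y) + y \<bullet> (P *\<^sub>v y))"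
  using psd_four_block_iff[OF assms, of "1\<^sub>m n"] by simp

text \<open>The \<open>Qi\<close> terms of the four blocks form the single square at
  \<open>x + A^T y\<close>. Keeping \<open>y\<close> as a variable, instead of eliminating it by a
  Schur complement, leaves the criterion linear in \<open>P\<close> and \<open>Pc\<close>, so that
  monotonicity in \<open>Pc\<close> is immediate.\<close>

lemma psd_riccati_block_iff:
  assumes Qi: "sym_mat n Qi" and P: "sym_mat n P" and Pc: "sym_mat n Pc"
    and A: "A \<in> carrier_mat n n"
  shows "psd_mat (n + n) (four_block_mat (Qi - P) (Qi * transpose_mat A)
      (A * Qi) (Pc + A * Qi * transpose_mat A)) \<longleftrightarrow>
    (\<forall>x \<in> carrier_vec n. \<forall>y \<in> carrier_vec n.
      x \<bullet> (P *\<^sub>v x) \<le> (x + transpose_mat A *\<^sub>v y) \<bullet> (Qi *\<^sub>v (x + transpose_mat A *\<^sub>v y)) + y \<bullet> (Pc *\<^sub>v y))"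
proof -
  have carr: "Qi \<in> carrier_mat n n" "P \<in> carrier_mat n n" "Pc \<in> carrier_mat n n"
    "transpose_mat A \<in> carrier_mat n n" using assms by simp_all
  have tr: "A * Qi = transpose_mat (Qi * transpose_mat A)"
    using transpose_mult[OF carr(1,4)] Qi by (simp add: sym_mat_def)
  have D1: "sym_mat n (Qi - P)" using Qi P by (rule sym_mat_minus)
  have cong: "sym_mat n (A * Qi * transpose_mat A)" using Qi A by (rule sym_mat_congruence)
  have D2: "sym_mat n (Pc + A * Qi * transpose_mat A)" using Pc cong by (rule sym_mat_add)
  have C: "Qi * transpose_mat A \<in> carrier_mat n n" using carr by simp
  have "0 \<le> x \<bullet> ((Qi - P) *\<^sub>v x) + 2 * (x \<bullet> ((Qi * transpose_mat A) *\<^sub>v y)) +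
        y \<bullet> ((Pc + A * Qi * transpose_mat A) *\<^sub>v y) \<longleftrightarrow>
      x \<bullet> (P *\<^sub>v x) \<le> (x + transpose_mat A *\<^sub>v y) \<bullet> (Qi *\<^sub>v (x + transpose_mat A *\<^sub>v y)) + y \<bullet> (Pc *\<^sub>v y)"
    if x: "x \<in> carrier_vec n" and y: "y \<in> carrier_vec n" for x y
  proof -
    have Ay: "transpose_mat A *\<^sub>v y \<in> carrier_vec n" using carr(4) y by (rule mult_mat_vec_carrier)
    show ?thesis
      unfolding form_matrix_minus[OF carr(1,2) x x] form_add[OF Qi x Ay]
        form_matrix_add[OF carr(3) sym_mat_carrier[OF cong] y y]
        form_congruence[OF carr(1) A y y] assoc_mult_mat_vec[OF carr(1,4) y]
      by auto
  qed
  then show ?thesis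
    using psd_four_block_iff[OF D1 D2 C, folded tr] by simp
qed

section \<open>One step of the Riccati recursion\<close>

lemma h_map_pd:
  assumes "pd_mat n M" "A t \<in> carrier_mat n n" "pd_mat n (Q t)"
  shows "pd_mat n (h_map A Q t M)"
proof -
  have psd: "psd_mat n (transpose_mat (A t) * M * A t)"
    using psd_congruence[OF pd_imp_psd[OF assms(1)], of "transpose_mat (A t)" n] assms(2) by simp
  have "Q t + transpose_mat (A t) * M * A t = transpose_mat (A t) * M * A t + Q t"
    by (rule comm_add_mat[OF sym_mat_carrier[OF pd_imp_sym[OF assms(3)]]
          sym_mat_carrier[OF psd_imp_sym[OF psd]]])
  then show ?thesis
    using pd_psd_add[OF assms(3) psd] by (simp add: h_map_def)
qed

lemma h_map_mult_vec:
  assumes M: "M \<in> carrier_mat n n" and A: "A t \<in> carrier_mat n n" and Q: "Q t \<in> carrier_mat n n"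
    and u: "u \<in> carrier_vec n"
  shows "h_map A Q t M *\<^sub>v u = transpose_mat (A t) *\<^sub>v (M *\<^sub>v (A t *\<^sub>v u)) + Q t *\<^sub>v u"
proof -
  have At: "transpose_mat (A t) \<in> carrier_mat n n" using A by simp
  have Au: "A t *\<^sub>v u \<in> carrier_vec n" using A u by (rule mult_mat_vec_carrier)
  show ?thesis
    unfolding h_map_def
    using M A Q u At Au
    by (simp add: add_mult_distrib_mat_vec[of _ n n] assoc_mult_mat_vec[of _ n n _ n])
qed

text \<open>Young's inequality with weights \<open>Q\<close> and \<open>Kc\<close> for \<open>u = P x\<close> and \<open>x = z - A\<^sup>T y\<close>.\<close>

lemma riccati_lower_bound:
  assumes Pc: "pd_mat n Pc" and Kc: "mat_inverse Pc = Some Kc"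
    and P: "pd_mat n P" and inv: "mat_inverse P = Some (h_map A Q t Kc)"
    and A: "A t \<in> carrier_mat n n" and Q: "pd_mat n (Q t)"
    and x: "x \<in> carrier_vec n" and y: "y \<in> carrier_vec n"
  defines "z \<equiv> x + transpose_mat (A t) *\<^sub>v y"
  shows "x \<bullet> (P *\<^sub>v x) \<le> z \<bullet> (mat_inv (Q t) *\<^sub>v z) + y \<bullet> (Pc *\<^sub>v y)"
proof -
  have carr: "P \<in> carrier_mat n n" "Pc \<in> carrier_mat n n" "Q t \<in> carrier_mat n n"
    "transpose_mat (A t) \<in> carrier_mat n n"
    using P Pc Q A by simp_all
  have Kcc: "Kc \<in> carrier_mat n n" using mat_inverse_SomeD[OF carr(2) Kc] by simp
  \<comment> \<open>\<open>h_map A Q t Kc\<close> maps this \<open>u\<close> back to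
    \<open>x\<close>, which splits \<open>x\<close> into a \<open>Kc\<close> part and a
    \<open>Q t\<close> part.\<close>
  define u where "u = P *\<^sub>v x"
  define w where "w = A t *\<^sub>v u"
  have u: "u \<in> carrier_vec n" unfolding u_def using carr(1) x by (rule mult_mat_vec_carrier)
  have w: "w \<in> carrier_vec n" unfolding w_def using A u by (rule mult_mat_vec_carrier)
  have Aty: "transpose_mat (A t) *\<^sub>v y \<in> carrier_vec n" using carr(4) y by (rule mult_mat_vec_carrier)
  have z: "z \<in> carrier_vec n" unfolding z_def using x Aty by simp
  have Qu: "Q t *\<^sub>v u \<in> carrier_vec n" using carr(3) u by (rule mult_mat_vec_carrier)
  have Kw: "Kc *\<^sub>v w \<in> carrier_vec n" using Kcc w by (rule mult_mat_vec_carrier)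
  have AKw: "transpose_mat (A t) *\<^sub>v (Kc *\<^sub>v w) \<in> carrier_vec n"
    using carr(4) Kw by (rule mult_mat_vec_carrier)
  have "x = h_map A Q t Kc *\<^sub>v u"
    unfolding u_def using mat_inverse_mult_vec(2)[OF carr(1) inv x] by simp
  also have "\<dots> = transpose_mat (A t) *\<^sub>v (Kc *\<^sub>v w) + Q t *\<^sub>v u"
    unfolding w_def by (rule h_map_mult_vec) (use Kcc A carr u in auto)
  finally have x_eq: "x = transpose_mat (A t) *\<^sub>v (Kc *\<^sub>v w) + Q t *\<^sub>v u" .
  have adj: "u \<bullet> (transpose_mat (A t) *\<^sub>v b) = w \<bullet> b" if b: "b \<in> carrier_vec n" for b
    using transpose_vec_mult_scalar[OF carr(4) b u] b u unfolding w_def by simp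
  have ux: "u \<bullet> x = w \<bullet> (Kc *\<^sub>v w) + u \<bullet> (Q t *\<^sub>v u)"
    using scalar_prod_add_distrib[OF u AKw Qu] adj[OF Kw] x_eq by simp
  have uz: "u \<bullet> z = u \<bullet> x + w \<bullet> y"
    unfolding z_def using scalar_prod_add_distrib[OF u x Aty] adj[OF y] by simp
  have "0 \<le> (- u) \<bullet> (Q t *\<^sub>v (- u)) + 2 * ((- u) \<bullet> z) + z \<bullet> (mat_inv (Q t) *\<^sub>v z)"
    using u z by (intro young_inverse_form[OF Q pd_mat_inv(1)[OF Q]]) simp_all
  then have 1: "0 \<le> u \<bullet> (Q t *\<^sub>v u) - 2 * (u \<bullet> z) + z \<bullet> (mat_inv (Q t) *\<^sub>v z)"
    using form_uminus[OF carr(3) u] u z by simp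
  have 2: "0 \<le> y \<bullet> (Pc *\<^sub>v y) + 2 * (w \<bullet> y) + w \<bullet> (Kc *\<^sub>v w)"
    using young_inverse_form[OF Pc Kc y w] comm_scalar_prod[OF w y] by simp
  have "x \<bullet> (P *\<^sub>v x) = u \<bullet> x" unfolding u_def[symmetric] by (rule comm_scalar_prod[OF x u])
  \<comment> \<open>In the sum of \<open>1\<close> and \<open>2\<close> the terms in
    \<open>w \<bullet> y\<close> cancel by \<open>uz\<close>; by \<open>ux\<close> the
    \<open>Q t\<close> and \<open>Kc\<close> terms together with the remaining
    \<open>- 2 * (u \<bullet> x)\<close> leave \<open>- (u \<bullet> x)\<close>.\<close>
  with 1 2 ux uz show ?thesis by simp
qed

text \<open>Both uses of Young's inequality in \<open>riccati_lower_bound\<close> become equalities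
  at the same \<open>y\<close>. Equality for the weight \<open>Pc\<close> forces
  \<open>y = - Kc w\<close>; then \<open>A^T y\<close> cancels the \<open>Kc\<close> part of
  \<open>x\<close> and leaves \<open>Q t u\<close>, the equality case for the weight
  \<open>Q t\<close>.\<close>

lemma riccati_attained:
  assumes Pc: "pd_mat n Pc" and Kc: "mat_inverse Pc = Some Kc"
    and P: "pd_mat n P" and inv: "mat_inverse P = Some (h_map A Q t Kc)"
    and A: "A t \<in> carrier_mat n n" and Q: "pd_mat n (Q t)"
    and x: "x \<in> carrier_vec n"
  obtains y where "y \<in> carrier_vec n"
    "(x + transpose_mat (A t) *\<^sub>v y) \<bullet> (mat_inv (Q t) *\<^sub>v (x + transpose_mat (A t) *\<^sub>v y))
      + y \<bullet> (Pc *\<^sub>v y) = x \<bullet> (P *\<^sub>v x)"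
proof -
  have carr: "P \<in> carrier_mat n n" "Pc \<in> carrier_mat n n" "Q t \<in> carrier_mat n n"
    "transpose_mat (A t) \<in> carrier_mat n n"
    using P Pc Q A by simp_all
  have Kcc: "Kc \<in> carrier_mat n n" using mat_inverse_SomeD[OF carr(2) Kc] by simp
  define u where "u = P *\<^sub>v x"
  define w where "w = A t *\<^sub>v u"
  define y where "y = - (Kc *\<^sub>v w)"
  have u: "u \<in> carrier_vec n" unfolding u_def using carr(1) x by (rule mult_mat_vec_carrier)
  have w: "w \<in> carrier_vec n" unfolding w_def using A u by (rule mult_mat_vec_carrier)
  have Qu: "Q t *\<^sub>v u \<in> carrier_vec n" using carr(3) u by (rule mult_mat_vec_carrier)
  have Kw: "Kc *\<^sub>v w \<in> carrier_vec n" using Kcc w by (rule mult_mat_vec_carrier)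
  have AKw: "transpose_mat (A t) *\<^sub>v (Kc *\<^sub>v w) \<in> carrier_vec n"
    using carr(4) Kw by (rule mult_mat_vec_carrier)
  have y: "y \<in> carrier_vec n" unfolding y_def using Kw by simp
  have "x = h_map A Q t Kc *\<^sub>v u"
    unfolding u_def using mat_inverse_mult_vec(2)[OF carr(1) inv x] by simp
  also have "\<dots> = transpose_mat (A t) *\<^sub>v (Kc *\<^sub>v w) + Q t *\<^sub>v u"
    unfolding w_def by (rule h_map_mult_vec) (use Kcc A carr u in auto)
  finally have x_eq: "x = transpose_mat (A t) *\<^sub>v (Kc *\<^sub>v w) + Q t *\<^sub>v u" .
  have "u \<bullet> (transpose_mat (A t) *\<^sub>v (Kc *\<^sub>v w)) = w \<bullet> (Kc *\<^sub>v w)"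
    using transpose_vec_mult_scalar[OF carr(4) Kw u] u unfolding w_def by simp
  then have ux: "u \<bullet> x = w \<bullet> (Kc *\<^sub>v w) + u \<bullet> (Q t *\<^sub>v u)"
    using scalar_prod_add_distrib[OF u AKw Qu] x_eq by simp
  have "transpose_mat (A t) *\<^sub>v y = - (transpose_mat (A t) *\<^sub>v (Kc *\<^sub>v w))"
    unfolding y_def by (rule mult_mat_vec_uminus[OF carr(4) Kw])
  moreover have "a + b + - a = b" if "a \<in> carrier_vec n" "b \<in> carrier_vec n" for a b :: "real vec"
    using that by (intro eq_vecI) auto
  ultimately have z: "x + transpose_mat (A t) *\<^sub>v y = Q t *\<^sub>v u"
    using AKw Qu x_eq by metis
  have Qz: "mat_inv (Q t) *\<^sub>v (Q t *\<^sub>v u) = u"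
    by (rule mat_inverse_mult_vec[OF carr(3) pd_mat_inv(1)[OF Q] u])
  have "y \<bullet> (Pc *\<^sub>v y) = (Kc *\<^sub>v w) \<bullet> w"
    unfolding y_def form_uminus[OF carr(2) Kw] mat_inverse_mult_vec(1)[OF carr(2) Kc w] ..
  then have "(Q t *\<^sub>v u) \<bullet> u + y \<bullet> (Pc *\<^sub>v y) = u \<bullet> x"
    using ux comm_scalar_prod[OF Kw w] comm_scalar_prod[OF Qu u] by simp
  also have "\<dots> = x \<bullet> (P *\<^sub>v x)" unfolding u_def[symmetric] by (rule comm_scalar_prod[OF u x])
  finally show thesis using y z Qz that by simp
qed

section \<open>Comparing the two problems\<close>

locale lq_scheduling =
  fixes n N T :: nat and m :: "nat \<Rightarrow> nat"
    and A Q :: "nat \<Rightarrow> real mat"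
    and B R :: "nat \<Rightarrow> nat \<Rightarrow> real mat"
    and W :: "int \<Rightarrow> real mat"
  assumes A: "t < T \<Longrightarrow> A t \<in> carrier_mat n n"
    and B: "t < T \<Longrightarrow> j \<in> {1..N} \<Longrightarrow> B t j \<in> carrier_mat n (m j)"
    and R: "t < T \<Longrightarrow> j \<in> {1..N} \<Longrightarrow> pd_mat (m j) (R t j)"
    and Q: "t \<le> T \<Longrightarrow> pd_mat n (Q t)"
    and W: "s \<in> {-1..int T - 1} \<Longrightarrow> psd_mat n (W s)"
begin

section \<open>Positive definiteness of exact points\<close>

lemma BRB_psd: "t < T \<Longrightarrow> j \<in> {1..N} \<Longrightarrow> psd_mat n (BRB B R t j)"
  unfolding BRB_def by (rule psd_congruence[OF pd_imp_psd[OF pd_mat_inv(2)[OF R]] B])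

lemma Wbar_psd:
  assumes "t < T"
  shows "psd_mat n (Wbar A W t)"
proof -
  have "int t - 1 \<in> {-1..int T - 1}" using assms by auto
  from psd_congruence[OF W[OF this] A[OF assms]] show ?thesis by (simp add: Wbar_def)
qed

text \<open>(S) asks only for symmetric invertible matrices. Positive definiteness is inherited
  backward from \<open>P T\<close>, because adding a semidefinite \<open>BRB\<close>, inverting and
  applying \<open>h_map\<close> all preserve it.\<close>

lemma S_feasible_pd:
  assumes S: "S_feasible n N T A B R Q (\<sigma>, K, Kc, P, Pc)"
  shows S_feasible_pd_P: "t \<le> T \<Longrightarrow> pd_mat n (P t)"
    and S_feasible_pd_Pc: "t < T \<Longrightarrow> pd_mat n (Pc t)"
    and S_feasible_pd_Kc: "t < T \<Longrightarrow> pd_mat n (Kc t)"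
proof -
  have pd_step: "pd_mat n (Pc t) \<and> pd_mat n (Kc t) \<and> pd_mat n (P t)"
    if t: "t < T" and P: "pd_mat n (P (Suc t))" for t
  proof -
    from S t have eqs: "\<sigma> t \<in> {1..N}" "mat_inverse (Pc t) = Some (Kc t)"
        "Pc t = P (Suc t) + BRB B R t (\<sigma> t)" "mat_inverse (P t) = Some (h_map A Q t (Kc t))"
        "sym_mat n (P t)"
      by (auto simp: S_feasible_def)
    have Pc: "pd_mat n (Pc t)" using pd_psd_add[OF P BRB_psd[OF t eqs(1)]] eqs(3) by simp
    have Kc: "pd_mat n (Kc t)" using pd_mat_inverseD[OF Pc eqs(2)] .
    have h: "pd_mat n (h_map A Q t (Kc t))" using h_map_pd[where A = A and Q = Q, OF Kc A[OF t] Q] t by simp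
    have "mat_inverse (h_map A Q t (Kc t)) = Some (P t)"
      using mat_inverse_sym[OF sym_mat_carrier[OF eqs(5)] eqs(4)] .
    with h have "pd_mat n (P t)" by (rule pd_mat_inverseD)
    with Pc Kc show ?thesis by simp
  qed
  show P: "pd_mat n (P t)" if "t \<le> T" for t
    using that
  proof (induction rule: inc_induct)
    case base
    then show ?case using S pd_mat_inv(2)[OF Q[of T]] by (simp add: S_feasible_def)
  next
    case (step t)
    then show ?case using pd_step by blast
  qed
  show "t < T \<Longrightarrow> pd_mat n (Pc t)" "t < T \<Longrightarrow> pd_mat n (Kc t)"
    using pd_step[of t] P[of "Suc t"] by simp_all
qed

text \<open>Both matrix inequalities are Young's inequality: the first with weight
  \<open>Kc t\<close>, whose inverse is \<open>Pc t\<close>, the second through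
  \<open>riccati_lower_bound\<close>.\<close>

lemma S_feasible_imp_R_feasible:
  assumes S: "S_feasible n N T A B R Q (\<sigma>, K, Kc, P, Pc)" and V: "matched N T B R \<sigma> V"
  shows "R_feasible n N T A B R Q (Kc, Pc, P, V)"
proof -
  note pd = S_feasible_pd[OF S]
  have lmi: "sym_mat n (Kc t) \<and> sym_mat n (Pc t) \<and> sym_mat n (V t) \<and>
      Pc t = P (Suc t) + V t \<and> V t \<in> V_set N B R t \<and>
      psd_mat (n + n) (four_block_mat (Kc t) (1\<^sub>m n) (1\<^sub>m n) (Pc t)) \<and>
      psd_mat (n + n) (four_block_mat
          (mat_inv (Q t) - P t)         (mat_inv (Q t) * transpose_mat (A t))
          (A t * mat_inv (Q t))         (Pc t + A t * mat_inv (Q t) * transpose_mat (A t)))"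
    if t: "t < T" for t
  proof -
    from S t have eqs: "mat_inverse (Pc t) = Some (Kc t)"
        "Pc t = P (Suc t) + BRB B R t (\<sigma> t)" "mat_inverse (P t) = Some (h_map A Q t (Kc t))"
        "sym_mat n (P t)"
      by (auto simp: S_feasible_def)
    have V_eq: "\<sigma> t \<in> {1..N}" "V t = BRB B R t (\<sigma> t)" using V t by (auto simp: matched_def)
    have Pc: "pd_mat n (Pc t)" and Kc: "pd_mat n (Kc t)" and P: "pd_mat n (P t)" and Qt: "pd_mat n (Q t)"
      using pd[of t] Q[of t] t by simp_all
    have Kc_inv: "mat_inverse (Kc t) = Some (Pc t)"
      by (rule mat_inverse_sym[OF sym_mat_carrier[OF pd_imp_sym[OF Pc]] eqs(1)])
    have "psd_mat (n + n) (four_block_mat (Kc t) (1\<^sub>m n) (1\<^sub>m n) (Pc t))"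
      using psd_inverse_block_iff[OF pd_imp_sym[OF Kc] pd_imp_sym[OF Pc]] young_inverse_form[OF Kc Kc_inv]
      by blast
    moreover have "psd_mat (n + n) (four_block_mat
          (mat_inv (Q t) - P t)         (mat_inv (Q t) * transpose_mat (A t))
          (A t * mat_inv (Q t))         (Pc t + A t * mat_inv (Q t) * transpose_mat (A t)))"
      using psd_riccati_block_iff[OF pd_imp_sym[OF pd_mat_inv(2)[OF Qt]] eqs(4) pd_imp_sym[OF Pc] A[OF t]]
        riccati_lower_bound[where A = A, OF Pc eqs(1) P eqs(3) A[OF t] Qt]
      by blast
    moreover have "sym_mat n (V t)" using BRB_psd[OF t V_eq(1)] V_eq(2) by simp
    moreover have "V t \<in> V_set N B R t" using V_eq by (auto simp: V_set_def)
    ultimately show ?thesis using Pc Kc eqs(2) V_eq(2) by simp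
  qed
  moreover have "\<forall>t\<le>T. sym_mat n (P t)" using pd(1) by simp
  moreover have "P T = mat_inv (Q T)" using S by (simp add: S_feasible_def)
  ultimately show ?thesis unfolding R_feasible_def by blast
qed

text \<open>The claims are proved together because the order of \<open>Pc\<close> and
  \<open>Pc'\<close> is also part of the inductive step for \<open>P\<close>. There the second
  matrix inequality is tested only at the \<open>y\<close> attaining the Riccati value, where
  replacing \<open>Pc\<close> by the larger \<open>Pc'\<close> gives exactly the form of
  \<open>P'\<close>. For \<open>Kc\<close> the first one is tested at \<open>y = - Kc' x\<close>,
  which minimizes its \<open>y\<close>-dependent part when \<open>Pc\<close> is replaced by
  \<open>Pc'\<close>.\<close>

lemma R_feasible_compare:
  assumes S: "S_feasible n N T A B R Q (\<sigma>, K', Kc', P', Pc')"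
    and Rf: "R_feasible n N T A B R Q (Kc, Pc, P, V)"
    and V: "matched N T B R \<sigma> V"
  shows compare_P: "t \<le> T \<Longrightarrow> x \<in> carrier_vec n \<Longrightarrow> x \<bullet> (P t *\<^sub>v x) \<le> x \<bullet> (P' t *\<^sub>v x)"
    and compare_Pc: "t < T \<Longrightarrow> x \<in> carrier_vec n \<Longrightarrow> x \<bullet> (Pc t *\<^sub>v x) \<le> x \<bullet> (Pc' t *\<^sub>v x)"
    and compare_Kc: "t < T \<Longrightarrow> x \<in> carrier_vec n \<Longrightarrow> x \<bullet> (Kc' t *\<^sub>v x) \<le> x \<bullet> (Kc t *\<^sub>v x)"
proof -
  note pd = S_feasible_pd[OF S]
  have Pc_le: "y \<bullet> (Pc t *\<^sub>v y) \<le> y \<bullet> (Pc' t *\<^sub>v y)"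
    if t: "t < T" and P_le: "\<And>x. x \<in> carrier_vec n \<Longrightarrow> x \<bullet> (P (Suc t) *\<^sub>v x) \<le> x \<bullet> (P' (Suc t) *\<^sub>v x)"
      and y: "y \<in> carrier_vec n" for t y
  proof -
    have Vt: "V t \<in> carrier_mat n n" "V t = BRB B R t (\<sigma> t)"
      using Rf V t by (auto simp: R_feasible_def matched_def)
    have eqs: "Pc t = P (Suc t) + V t" "Pc' t = P' (Suc t) + V t"
      using Rf S t Vt by (auto simp: R_feasible_def S_feasible_def)
    have carr: "P (Suc t) \<in> carrier_mat n n" "P' (Suc t) \<in> carrier_mat n n"
      using Rf S t by (auto simp: R_feasible_def S_feasible_def)
    show ?thesis
      unfolding eqs form_matrix_add[OF carr(1) Vt(1) y y] form_matrix_add[OF carr(2) Vt(1) y y]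
      using P_le[OF y] by simp
  qed
  show P_le: "x \<bullet> (P t *\<^sub>v x) \<le> x \<bullet> (P' t *\<^sub>v x)" if "t \<le> T" "x \<in> carrier_vec n" for t x
    using that
  proof (induction arbitrary: x rule: inc_induct)
    case base
    then show ?case using S Rf by (simp add: S_feasible_def R_feasible_def)
  next
    case (step t)
    have t: "t < T" by fact
    have Qt: "pd_mat n (Q t)" using Q t by simp
    have inv: "mat_inverse (Pc' t) = Some (Kc' t)" "mat_inverse (P' t) = Some (h_map A Q t (Kc' t))"
      using S t by (auto simp: S_feasible_def)
    have sym: "sym_mat n (P t)" "sym_mat n (Pc t)" and lmi: "psd_mat (n + n) (four_block_mat
          (mat_inv (Q t) - P t)         (mat_inv (Q t) * transpose_mat (A t))
          (A t * mat_inv (Q t))         (Pc t + A t * mat_inv (Q t) * transpose_mat (A t)))"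
      using Rf t by (auto simp: R_feasible_def)
    obtain y where y: "y \<in> carrier_vec n"
      "(x + transpose_mat (A t) *\<^sub>v y) \<bullet> (mat_inv (Q t) *\<^sub>v (x + transpose_mat (A t) *\<^sub>v y))
        + y \<bullet> (Pc' t *\<^sub>v y) = x \<bullet> (P' t *\<^sub>v x)"
      using riccati_attained[where A = A, OF pd(2)[OF t] inv(1) pd(1) inv(2) A[OF t] Qt step.prems] t
      by auto
    have "x \<bullet> (P t *\<^sub>v x) \<le>
        (x + transpose_mat (A t) *\<^sub>v y) \<bullet> (mat_inv (Q t) *\<^sub>v (x + transpose_mat (A t) *\<^sub>v y))
        + y \<bullet> (Pc t *\<^sub>v y)"
      using lmi psd_riccati_block_iff[OF pd_imp_sym[OF pd_mat_inv(2)[OF Qt]] sym A[OF t]] step.prems y(1)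
      by blast
    also have "\<dots> \<le> x \<bullet> (P' t *\<^sub>v x)"
      using y(2) Pc_le[OF t step.IH y(1)] by simp
    finally show ?case .
  qed
  show Pc_le': "x \<bullet> (Pc t *\<^sub>v x) \<le> x \<bullet> (Pc' t *\<^sub>v x)" if "t < T" "x \<in> carrier_vec n" for t x
    using that by (intro Pc_le P_le) simp_all
  show "x \<bullet> (Kc' t *\<^sub>v x) \<le> x \<bullet> (Kc t *\<^sub>v x)" if t: "t < T" and x: "x \<in> carrier_vec n" for t x
  proof -
    let ?y = "Kc' t *\<^sub>v x"
    have sym: "sym_mat n (Kc t)" "sym_mat n (Pc t)"
      and lmi: "psd_mat (n + n) (four_block_mat (Kc t) (1\<^sub>m n) (1\<^sub>m n) (Pc t))"
      using Rf t by (auto simp: R_feasible_def)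
    have inv: "mat_inverse (Pc' t) = Some (Kc' t)" and Pc': "Pc' t \<in> carrier_mat n n"
      using S t by (auto simp: S_feasible_def)
    have y: "?y \<in> carrier_vec n"
      using mat_inverse_SomeD(3)[OF Pc' inv] x by (rule mult_mat_vec_carrier)
    have "0 \<le> x \<bullet> (Kc t *\<^sub>v x) + 2 * (x \<bullet> (- ?y)) + (- ?y) \<bullet> (Pc t *\<^sub>v (- ?y))"
      using lmi psd_inverse_block_iff[OF sym] x y by (metis uminus_carrier_vec)
    moreover have "x \<bullet> (- ?y) = - (x \<bullet> ?y)" by (rule scalar_prod_uminus_carrier[OF x y])
    moreover have "(- ?y) \<bullet> (Pc t *\<^sub>v (- ?y)) = ?y \<bullet> (Pc t *\<^sub>v ?y)"
      by (rule form_uminus[OF sym_mat_carrier[OF sym(2)] y])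
    moreover have "?y \<bullet> (Pc t *\<^sub>v ?y) \<le> ?y \<bullet> (Pc' t *\<^sub>v ?y)" by (rule Pc_le'[OF t y])
    moreover have "?y \<bullet> (Pc' t *\<^sub>v ?y) = x \<bullet> ?y"
      using mat_inverse_mult_vec(1)[OF Pc' inv x] comm_scalar_prod[OF y x] by simp
    ultimately show ?thesis by simp
  qed
qed

section \<open>Consequences of the comparison for costs and uniqueness\<close>

lemma compare_Kc_psd:
  assumes S: "S_feasible n N T A B R Q (\<sigma>, K', Kc', P', Pc')"
    and Rf: "R_feasible n N T A B R Q (Kc, Pc, P, V)"
    and V: "matched N T B R \<sigma> V" and t: "t < T"
  shows "psd_mat n (Kc t - Kc' t)"
proof -
  have sym: "sym_mat n (Kc t)" "sym_mat n (Kc' t)"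
    using S Rf t by (auto simp: S_feasible_def R_feasible_def)
  have "0 \<le> x \<bullet> ((Kc t - Kc' t) *\<^sub>v x)" if x: "x \<in> carrier_vec n" for x
    unfolding form_matrix_minus[OF sym[THEN sym_mat_carrier] x x]
    using compare_Kc[OF S Rf V t x] by simp
  then show ?thesis using sym_mat_minus[OF sym] by (simp add: psd_mat_def)
qed

lemma compare_stage_cost:
  assumes S: "S_feasible n N T A B R Q (\<sigma>, K', Kc', P', Pc')"
    and Rf: "R_feasible n N T A B R Q (Kc, Pc, P, V)"
    and V: "matched N T B R \<sigma> V" and t: "t < T"
  shows "mat_trace (Kc' t * Wbar A W t) \<le> mat_trace (Kc t * Wbar A W t)"
proof -
  have carr: "Kc t \<in> carrier_mat n n" "Kc' t \<in> carrier_mat n n" "Wbar A W t \<in> carrier_mat n n"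
    using S Rf Wbar_psd[OF t] t by (auto simp: S_feasible_def R_feasible_def)
  show ?thesis
    using mat_trace_psd_mult_nonneg[OF compare_Kc_psd[OF assms] Wbar_psd[OF t]]
      mat_trace_minus_mult[OF carr] by simp
qed

lemma compare_total_cost:
  assumes "S_feasible n N T A B R Q (\<sigma>, K', Kc', P', Pc')"
    and "R_feasible n N T A B R Q (Kc, Pc, P, V)"
    and "matched N T B R \<sigma> V"
  shows "total_cost T A W Kc' \<le> total_cost T A W Kc"
  unfolding total_cost_def by (intro sum_mono compare_stage_cost[OF assms]) simp

text \<open>Stage costs are ordered termwise, so equal totals make them agree at every stage, and a
  zero trace against a positive definite matrix kills the semidefinite difference
  \<open>Kc t - Kc' t\<close>. The first matrix inequality then gives the reverse order of
  \<open>Pc t\<close> and \<open>Pc' t\<close>. Cancelling the common \<open>V t\<close> reaches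
  \<open>P\<close> at \<open>Suc t\<close>; nothing is learned about \<open>P 0\<close>.\<close>

lemma compare_equality:
  assumes S: "S_feasible n N T A B R Q (\<sigma>, K', Kc', P', Pc')"
    and Rf: "R_feasible n N T A B R Q (Kc, Pc, P, V)"
    and V: "matched N T B R \<sigma> V" and t: "t < T"
    and cost: "total_cost T A W Kc' = total_cost T A W Kc"
    and Wbar: "pd_mat n (Wbar A W t)"
  shows "Kc' t = Kc t \<and> Pc' t = Pc t \<and> P' (Suc t) = P (Suc t)"
proof -
  have sym: "sym_mat n (Kc t)" "sym_mat n (Kc' t)" "sym_mat n (Pc t)" "sym_mat n (Pc' t)"
    "sym_mat n (P (Suc t))" "sym_mat n (P' (Suc t))"
    and lmi: "psd_mat (n + n) (four_block_mat (Kc t) (1\<^sub>m n) (1\<^sub>m n) (Pc t))"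
    and inv: "mat_inverse (Pc' t) = Some (Kc' t)"
    and Pc_eq: "Pc t = P (Suc t) + V t" "Pc' t = P' (Suc t) + BRB B R t (\<sigma> t)"
    using S Rf t by (auto simp: S_feasible_def R_feasible_def)
  have "\<sigma> t \<in> {1..N}" and Vt: "V t = BRB B R t (\<sigma> t)" using V t by (auto simp: matched_def)
  then have V_sym: "sym_mat n (V t)" using BRB_psd[OF t] by simp
  have "mat_trace (Kc t * Wbar A W t) = mat_trace (Kc' t * Wbar A W t)"
  proof (rule ccontr)
    assume "mat_trace (Kc t * Wbar A W t) \<noteq> mat_trace (Kc' t * Wbar A W t)"
    then have "mat_trace (Kc' t * Wbar A W t) < mat_trace (Kc t * Wbar A W t)"
      using compare_stage_cost[OF S Rf V t] by simp
    then have "total_cost T A W Kc' < total_cost T A W Kc"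
      unfolding total_cost_def using t compare_stage_cost[OF S Rf V]
      by (intro sum_strict_mono_ex1) auto
    with cost show False by simp
  qed
  then have tr: "mat_trace ((Kc t - Kc' t) * Wbar A W t) = 0"
    using mat_trace_minus_mult[of "Kc t" n "Kc' t" "Wbar A W t"] sym Wbar by simp
  have Kc_eq: "Kc' t = Kc t"
  proof (rule sym_mat_eqI_form[OF sym(2,1)])
    fix v :: "real vec" assume v: "v \<in> carrier_vec n"
    have "v \<bullet> ((Kc t - Kc' t) *\<^sub>v v) = 0"
      by (rule mat_trace_pd_mult_zero[OF compare_Kc_psd[OF S Rf V t] Wbar tr v])
    then show "v \<bullet> (Kc' t *\<^sub>v v) = v \<bullet> (Kc t *\<^sub>v v)"
      unfolding form_matrix_minus[OF sym(1,2)[THEN sym_mat_carrier] v v] by simp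
  qed
  have Pc_eq': "Pc' t = Pc t"
  proof (rule sym_mat_eqI_form[OF sym(4,3)])
    fix v :: "real vec" assume v: "v \<in> carrier_vec n"
    let ?u = "Pc' t *\<^sub>v v"
    have u: "?u \<in> carrier_vec n"
      using sym_mat_carrier[OF sym(4)] v by (rule mult_mat_vec_carrier)
    \<comment> \<open>\<open>Kc t\<close> is now known to be the inverse of \<open>Pc' t\<close>, so
      its form at \<open>- ?u\<close> is \<open>?u \<bullet> v\<close>, which is also the form of
      \<open>Pc' t\<close> at \<open>v\<close>. Half of the cross term is thereby absorbed.\<close>
    have "0 \<le> (- ?u) \<bullet> (Kc t *\<^sub>v (- ?u)) + 2 * ((- ?u) \<bullet> v) + v \<bullet> (Pc t *\<^sub>v v)"
      using lmi psd_inverse_block_iff[OF sym(1,3)] u v by (metis uminus_carrier_vec)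
    moreover have "(- ?u) \<bullet> (Kc t *\<^sub>v (- ?u)) = ?u \<bullet> v"
      using form_uminus[OF sym_mat_carrier[OF sym(1)] u]
        mat_inverse_mult_vec(2)[OF sym_mat_carrier[OF sym(4)] inv v] Kc_eq by simp
    moreover have "(- ?u) \<bullet> v = - (?u \<bullet> v)" by (rule scalar_prod_uminus_carrier[OF u v])
    moreover have "?u \<bullet> v = v \<bullet> ?u" by (rule comm_scalar_prod[OF u v])
    ultimately have "v \<bullet> (Pc' t *\<^sub>v v) \<le> v \<bullet> (Pc t *\<^sub>v v)" by simp
    then show "v \<bullet> (Pc' t *\<^sub>v v) = v \<bullet> (Pc t *\<^sub>v v)"
      using compare_Pc[OF S Rf V t v] by simp
  qed
  have "P' (Suc t) = P (Suc t)"
  proof (rule sym_mat_eqI_form[OF sym(6,5)])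
    fix v :: "real vec" assume v: "v \<in> carrier_vec n"
    have "v \<bullet> ((P' (Suc t) + V t) *\<^sub>v v) = v \<bullet> ((P (Suc t) + V t) *\<^sub>v v)"
      using Pc_eq' Pc_eq Vt by simp
    then show "v \<bullet> (P' (Suc t) *\<^sub>v v) = v \<bullet> (P (Suc t) *\<^sub>v v)"
      unfolding form_matrix_add[OF sym(6)[THEN sym_mat_carrier] V_sym[THEN sym_mat_carrier] v v]
        form_matrix_add[OF sym(5)[THEN sym_mat_carrier] V_sym[THEN sym_mat_carrier] v v] by simp
  qed
  with Kc_eq Pc_eq' show ?thesis by simp
qed

text \<open>\<open>riccati \<sigma> s\<close> is the matrix $P_{T-s}$ generated by the schedule \<open>\<sigma>\<close>.\<close>

primrec riccati :: "(nat \<Rightarrow> nat) \<Rightarrow> nat \<Rightarrow> real mat" where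
  "riccati \<sigma> 0 = mat_inv (Q T)"
| "riccati \<sigma> (Suc s) = (let t = T - Suc s in
     mat_inv (h_map A Q t (mat_inv (riccati \<sigma> s + BRB B R t (\<sigma> t)))))"

text \<open>\<open>mat_inv\<close> is meaningful only for invertible arguments, so the recursion is
  defined blindly and positive definiteness, carried backward from \<open>T\<close>, certifies each
  inverse afterwards.\<close>

lemma S_feasible_exists:
  assumes \<sigma>: "\<And>t. t < T \<Longrightarrow> \<sigma> t \<in> {1..N}"
  obtains K Kc P Pc where "S_feasible n N T A B R Q (\<sigma>, K, Kc, P, Pc)"
proof -
  define P where "P t = riccati \<sigma> (T - t)" for t
  define Pc where "Pc t = P (Suc t) + BRB B R t (\<sigma> t)" for t
  define Kc where "Kc t = mat_inv (Pc t)" for t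
  have P_T: "P T = mat_inv (Q T)" by (simp add: P_def)
  have P_rec: "P t = mat_inv (h_map A Q t (Kc t))" if "t < T" for t
  proof -
    \<comment> \<open>\<open>riccati\<close> counts stages from the end; for \<open>t < T\<close>
      truncated subtraction is exact, so the stage it uses is \<open>t\<close> again.\<close>
    have "T - t = Suc (T - Suc t)" "T - Suc (T - Suc t) = t" using that by simp_all
    then show ?thesis by (simp add: P_def Kc_def Pc_def Let_def)
  qed
  have pd_step: "pd_mat n (Pc t) \<and> pd_mat n (h_map A Q t (Kc t)) \<and> pd_mat n (P t)"
    if t: "t < T" and P: "pd_mat n (P (Suc t))" for t
  proof -
    have Pc: "pd_mat n (Pc t)"
      unfolding Pc_def by (rule pd_psd_add[OF P BRB_psd[OF t \<sigma>[OF t]]])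
    have h: "pd_mat n (h_map A Q t (Kc t))"
      unfolding Kc_def using t by (intro h_map_pd pd_mat_inv(2)[OF Pc] A Q) simp_all
    show ?thesis using Pc h pd_mat_inv(2)[OF h] P_rec[OF t] by simp
  qed
  have P_pd: "pd_mat n (P t)" if "t \<le> T" for t
    using that
  proof (induction rule: inc_induct)
    case base
    then show ?case using pd_mat_inv(2)[OF Q[of T]] P_T by simp
  next
    case (step t)
    then show ?case using pd_step by blast
  qed
  have "S_feasible n N T A B R Q (\<sigma>, \<lambda>t. mat_inv (P t), Kc, P, Pc)"
  proof -
    have 1: "sym_mat n (mat_inv (P t)) \<and> sym_mat n (P t) \<and> mat_inverse (P t) = Some (mat_inv (P t))"
      if "t \<le> T" for t
      using pd_mat_inv[OF P_pd[OF that]] P_pd[OF that] by simp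
    have 2: "\<sigma> t \<in> {1..N} \<and> sym_mat n (Kc t) \<and> sym_mat n (Pc t) \<and>
        mat_inverse (Pc t) = Some (Kc t) \<and> Pc t = P (Suc t) + BRB B R t (\<sigma> t) \<and>
        mat_inverse (P t) = Some (h_map A Q t (Kc t))" if t: "t < T" for t
    proof -
      have Pc: "pd_mat n (Pc t)" and h: "pd_mat n (h_map A Q t (Kc t))"
        using pd_step[OF t] P_pd[of "Suc t"] t by simp_all
      have "mat_inverse (P t) = Some (h_map A Q t (Kc t))"
        unfolding P_rec[OF t]
        by (rule mat_inverse_sym[OF sym_mat_carrier[OF pd_imp_sym[OF h]] pd_mat_inv(1)[OF h]])
      then show ?thesis
        using \<sigma>[OF t] pd_mat_inv[OF Pc] Pc by (simp add: Kc_def Pc_def)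
    qed
    show ?thesis unfolding S_feasible_def using 1 2 P_T by blast
  qed
  then show thesis by (rule that)
qed

text \<open>Different \<open>j\<close> may give the same \<open>BRB B R t j\<close>, so the schedule
  is merely chosen; the results on optimality hold for every matching one.\<close>

lemma R_feasible_matched:
  assumes "R_feasible n N T A B R Q (Kc, Pc, P, V)"
  obtains \<sigma> where "matched N T B R \<sigma> V"
proof -
  have "\<forall>t. \<exists>j. t < T \<longrightarrow> j \<in> {1..N} \<and> V t = BRB B R t j"
    using assms by (auto simp: R_feasible_def V_set_def)
  then obtain \<sigma> where "\<forall>t. t < T \<longrightarrow> \<sigma> t \<in> {1..N} \<and> V t = BRB B R t (\<sigma> t)" by metis
  then show thesis by (intro that[of \<sigma>]) (simp add: matched_def)
qed

section \<open>Transfer of optimality between the two problems\<close>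

lemma S_optimal_iff:
  "S_optimal n N T A B R Q W (\<sigma>, K, Kc, P, Pc) \<longleftrightarrow>
    S_feasible n N T A B R Q (\<sigma>, K, Kc, P, Pc) \<and>
    (\<forall>\<sigma>' K' Kc' P' Pc'. S_feasible n N T A B R Q (\<sigma>', K', Kc', P', Pc') \<longrightarrow>
      total_cost T A W Kc \<le> total_cost T A W Kc')"
  by (auto simp: S_optimal_def is_arg_min_def not_less) blast+

lemma R_optimal_iff:
  "R_optimal n N T A B R Q W (Kc, Pc, P, V) \<longleftrightarrow>
    R_feasible n N T A B R Q (Kc, Pc, P, V) \<and>
    (\<forall>Kc' Pc' P' V'. R_feasible n N T A B R Q (Kc', Pc', P', V') \<longrightarrow>
      total_cost T A W Kc \<le> total_cost T A W Kc')"
  by (auto simp: R_optimal_def is_arg_min_def not_less)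

text \<open>This is why the relaxation does not lower the optimal value: the exact recursion for the
  schedule of a relaxed point competes in (S).\<close>

lemma S_feasible_below_R_feasible:
  assumes Rf: "R_feasible n N T A B R Q (Kc, Pc, P, V)" and V: "matched N T B R \<sigma> V"
  obtains K' Kc' P' Pc' where "S_feasible n N T A B R Q (\<sigma>, K', Kc', P', Pc')"
    "total_cost T A W Kc' \<le> total_cost T A W Kc"
proof -
  obtain K' Kc' P' Pc' where S: "S_feasible n N T A B R Q (\<sigma>, K', Kc', P', Pc')"
    using S_feasible_exists V unfolding matched_def by blast
  with compare_total_cost[OF S Rf V] that show thesis by blast
qed

lemma R_feasible_of_S_feasible:
  assumes S: "S_feasible n N T A B R Q (\<sigma>, K, Kc, P, Pc)"
  obtains V where "R_feasible n N T A B R Q (Kc, Pc, P, V)"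
proof -
  have "matched N T B R \<sigma> (\<lambda>t. BRB B R t (\<sigma> t))"
    using S by (auto simp: S_feasible_def matched_def)
  from S_feasible_imp_R_feasible[OF S this] show thesis by (rule that)
qed

text \<open>Forward, a competitor in (R) is undercut by the exact recursion for its own schedule,
  which (S) already admits. Backward, (R) contains all points of (S) at the same cost, so a
  minimizer over (R) that lies in (S) is a minimizer there. Feasibility in (S) stands on the right
  because an optimal relaxed point can violate the equalities.\<close>

lemma S_optimal_iff_R_optimal:
  assumes V: "matched N T B R \<sigma> V"
  shows "S_optimal n N T A B R Q W (\<sigma>, K, Kc, P, Pc) \<longleftrightarrow>
    S_feasible n N T A B R Q (\<sigma>, K, Kc, P, Pc) \<and> R_optimal n N T A B R Q W (Kc, Pc, P, V)"
proof
  assume opt: "S_optimal n N T A B R Q W (\<sigma>, K, Kc, P, Pc)"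
  then have S: "S_feasible n N T A B R Q (\<sigma>, K, Kc, P, Pc)" by (simp add: S_optimal_iff)
  have "total_cost T A W Kc \<le> total_cost T A W Kc2"
    if R2: "R_feasible n N T A B R Q (Kc2, Pc2, P2, V2)" for Kc2 Pc2 P2 V2
  proof -
    obtain \<sigma>2 where "matched N T B R \<sigma>2 V2" using R_feasible_matched[OF R2] .
    then obtain K' Kc' P' Pc' where "S_feasible n N T A B R Q (\<sigma>2, K', Kc', P', Pc')"
      "total_cost T A W Kc' \<le> total_cost T A W Kc2"
      using S_feasible_below_R_feasible[OF R2] by blast
    then show ?thesis using opt unfolding S_optimal_iff by (meson order_trans)
  qed
  then show "S_feasible n N T A B R Q (\<sigma>, K, Kc, P, Pc) \<and> R_optimal n N T A B R Q W (Kc, Pc, P, V)"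
    using S S_feasible_imp_R_feasible[OF S V] unfolding R_optimal_iff by blast
next
  assume "S_feasible n N T A B R Q (\<sigma>, K, Kc, P, Pc) \<and> R_optimal n N T A B R Q W (Kc, Pc, P, V)"
  then show "S_optimal n N T A B R Q W (\<sigma>, K, Kc, P, Pc)"
    unfolding S_optimal_iff R_optimal_iff by (meson R_feasible_of_S_feasible)
qed

text \<open>The witness is the exact recursion for the same \<open>\<sigma>\<close>, feasible in (R)
  with the same \<open>V\<close>. Costing no more than an optimum, it is optimal there, and the
  equivalence carries it to (S).\<close>

lemma R_optimal_imp_S_optimal:
  assumes opt: "R_optimal n N T A B R Q W (Kc, Pc, P, V)" and V: "matched N T B R \<sigma> V"
  shows "\<exists>K' Kc' P' Pc'. S_optimal n N T A B R Q W (\<sigma>, K', Kc', P', Pc') \<and>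
    total_cost T A W Kc' = total_cost T A W Kc \<and>
    (\<forall>t<T. pd_mat n (Wbar A W t) \<longrightarrow>
      Kc' t = Kc t \<and> Pc' t = Pc t \<and> P' (Suc t) = P (Suc t))"
proof -
  have Rf: "R_feasible n N T A B R Q (Kc, Pc, P, V)" using opt by (simp add: R_optimal_iff)
  obtain K' Kc' P' Pc' where S: "S_feasible n N T A B R Q (\<sigma>, K', Kc', P', Pc')"
    and le: "total_cost T A W Kc' \<le> total_cost T A W Kc"
    using S_feasible_below_R_feasible[OF Rf V] .
  have Rf': "R_feasible n N T A B R Q (Kc', Pc', P', V)"
    by (rule S_feasible_imp_R_feasible[OF S V])
  then have cost: "total_cost T A W Kc' = total_cost T A W Kc"
    using opt le unfolding R_optimal_iff by (meson order_antisym)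
  then have "R_optimal n N T A B R Q W (Kc', Pc', P', V)"
    using opt Rf' unfolding R_optimal_iff by auto
  then have "S_optimal n N T A B R Q W (\<sigma>, K', Kc', P', Pc')"
    using S S_optimal_iff_R_optimal[OF V] by blast
  then show ?thesis using cost compare_equality[OF S Rf V _ cost] by blast
qed

end

text \<open>The two problems have different variables, so \<open>matched\<close> makes precise when
  their points are the same solution. The second conjunct covers relaxed optima that violate the
  equalities: there the schedule and the cost carry over, and equality of matrices is claimed only
  where the cost determines them.\<close>

theorem theorem1:
  fixes n N T :: nat
    and m :: "nat \<Rightarrow> nat"
    and A Q :: "nat \<Rightarrow> real mat"
    and B R :: "nat \<Rightarrow> nat \<Rightarrow> real mat"
    and W :: "int \<Rightarrow> real mat"
  assumes "n \<ge> 1" and "N \<ge> 1" and "T \<ge> 1"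
    and "\<And>j. j \<in> {1..N} \<Longrightarrow> m j \<ge> 1"
    and "\<And>t. t < T \<Longrightarrow> A t \<in> carrier_mat n n"
    and "\<And>t j. t < T \<Longrightarrow> j \<in> {1..N} \<Longrightarrow> B t j \<in> carrier_mat n (m j)"
    and "\<And>t j. t < T \<Longrightarrow> j \<in> {1..N} \<Longrightarrow> pd_mat (m j) (R t j)"
    and "\<And>t. t \<le> T \<Longrightarrow> pd_mat n (Q t)"
    and "\<And>t. t \<in> {-1..int T - 1} \<Longrightarrow> psd_mat n (W t)"
  shows
    "(\<forall>\<sigma> K Kc P Pc V. matched N T B R \<sigma> V \<longrightarrow>
        (S_optimal n N T A B R Q W (\<sigma>, K, Kc, P, Pc) \<longleftrightarrow>
         S_feasible n N T A B R Q (\<sigma>, K, Kc, P, Pc) \<and> R_optimal n N T A B R Q W (Kc, Pc, P, V))) \<and>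
     (\<forall>Kc Pc P V. R_optimal n N T A B R Q W (Kc, Pc, P, V) \<longrightarrow>
        (\<exists>\<sigma>. matched N T B R \<sigma> V) \<and>
        (\<forall>\<sigma>. matched N T B R \<sigma> V \<longrightarrow>
          (\<exists>K' Kc' P' Pc'. S_optimal n N T A B R Q W (\<sigma>, K', Kc', P', Pc') \<and>
             total_cost T A W Kc' = total_cost T A W Kc \<and>
             (\<forall>t<T. pd_mat n (Wbar A W t) \<longrightarrow>
                Kc' t = Kc t \<and> Pc' t = Pc t \<and> P' (Suc t) = P (Suc t)))))"
proof -
  interpret lq_scheduling n N T m A Q B R W
  proof
    show "A t \<in> carrier_mat n n" if "t < T" for t using that by (rule assms(5))
    show "B t j \<in> carrier_mat n (m j)" if "t < T" "j \<in> {1..N}" for t j using that by (rule assms(6))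
    show "pd_mat (m j) (R t j)" if "t < T" "j \<in> {1..N}" for t j using that by (rule assms(7))
    show "pd_mat n (Q t)" if "t \<le> T" for t using that by (rule assms(8))
    show "psd_mat n (W s)" if "s \<in> {-1..int T - 1}" for s using that by (rule assms(9))
  qed
  have "\<exists>\<sigma>. matched N T B R \<sigma> V" if "R_optimal n N T A B R Q W (Kc, Pc, P, V)" for Kc Pc P V
  proof -
    have "R_feasible n N T A B R Q (Kc, Pc, P, V)" using that unfolding R_optimal_iff by blast
    then obtain \<sigma> where "matched N T B R \<sigma> V" by (rule R_feasible_matched)
    then show ?thesis by blast
  qed
  then show ?thesis
    by (intro conjI allI impI S_optimal_iff_R_optimal R_optimal_imp_S_optimal)
qed

end
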